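(* Let $n\ge 3$ be an integer, $s\in(0,1)$ and $q>1$. Consider the equation $$-\Delta u+(-\Delta)^s u=u^q\quad\text{in }\mathbb R^n.\qquad(\ast)$$ (1) If $1<q\le \frac{n}{n-2s}$, then $(\ast)$ has no positive distributional supersolutions. (2) If $q>\frac{n}{n-2s}$, then $(\ast)$ has a smooth bounded positive classical supersolution.
   Context: The fractional Laplacian is $$(-\Delta)^s u(x)=C_{n,s}\lim_{\varepsilon\searrow 0}\int_{\mathbb R^n\setminus B_\varepsilon(x)}\frac{u(x)-u(y)}{|x-y|^{n+2s}}\,dy,\qquad C_{n,s}=\frac{2^{2s}\Gamma(s+n/2)}{\pi^{n/2}|\Gamma(-s)|},$$ where $\Gamma(\cdot)$ in the constant is the Euler Gamma function. Set $$\mathcal L^{2s}(\mathbb R^n)=\Big\{u\in L^1_{loc}(\mathbb R^n):\int_{\mathbb R^n}\frac{|u(x)|}{1+|x|^{n+2s}}\,dx<\infty\Big\}.$$ A positive classical supersolution of $(\ast)$ is a positive function $u\in C^2(\mathbb R^n)\cap\mathcal L^{2s}(\mathbb R^n)$ with $-\Delta u+(-\Delta)^s u\ge u^q$ pointwise in $\mathbb R^n$. A positive distributional supersolution of $(\ast)$ is a positive (a.e.) function $u\in\mathcal L^{2s}(\mathbb R^n)\cap L^q_{loc}(\mathbb R^n)$ such that for every $\phi\in C_c^\infty(\mathbb R^n)$ with $\phi\ge 0$, $$\int_{\mathbb R^n}u\,[(-\Delta)\phi+(-\Delta)^s\phi]\,dx\ge\int_{\mathbb R^n}u^q\phi\,dx.$$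 (The left side is well defined since $|(-\Delta)^s\phi(x)|\le C/(1+|x|^{n+2s})$ for $\phi\in C_c^\infty(\mathbb R^n)$.) *)

theory Defs
  imports "HOL-Analysis.Analysis"
begin

text \<open>
  The Euclidean space is \<open>real ^ 'n\<close>, its dimension is \<open>CARD('n)\<close>, and all integrals are taken
  with respect to Lebesgue measure on Lebesgue measurable functions.
\<close>

definition partial_derivative :: "'n::finite \<Rightarrow> (real ^ 'n \<Rightarrow> real) \<Rightarrow> real ^ 'n \<Rightarrow> real" where
  "partial_derivative i u x = frechet_derivative u (at x) (axis i 1)"

text \<open>
  The class $C^k(\mathbb R^n)$. Differentiability is required at each step because
  \<^const>\<open>frechet_derivative\<close> has no meaning at points where it fails.
\<close>

primrec Ck :: "nat \<Rightarrow> (real ^ 'n::finite \<Rightarrow> real) \<Rightarrow> bool" where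
  "Ck 0 u \<longleftrightarrow> continuous_on UNIV u"
| "Ck (Suc k) u \<longleftrightarrow> (\<forall>x. u differentiable (at x)) \<and> (\<forall>i. Ck k (partial_derivative i u))"

definition smooth_fun :: "(real ^ 'n::finite \<Rightarrow> real) \<Rightarrow> bool" where
  "smooth_fun u \<longleftrightarrow> (\<forall>k. Ck k u)"

definition test_function :: "(real ^ 'n::finite \<Rightarrow> real) \<Rightarrow> bool" where
  "test_function \<phi> \<longleftrightarrow> smooth_fun \<phi> \<and> compact (closure {x. \<phi> x \<noteq> 0})"

definition laplacian :: "(real ^ 'n::finite \<Rightarrow> real) \<Rightarrow> real ^ 'n \<Rightarrow> real" where
  "laplacian u x = (\<Sum>i\<in>UNIV. partial_derivative i (partial_derivative i u) x)"

definition frac_const :: "nat \<Rightarrow> real \<Rightarrow> real" where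
  "frac_const n s =
     2 powr (2 * s) * Gamma (s + real n / 2) / (pi powr (real n / 2) * \<bar>Gamma (- s)\<bar>)"

text \<open>
  The operator $(-\Delta)^s$, with the minus sign included. For $0 < s < 1$ and $u$ of class
  $C^2$ in the weighted space \<open>L2s s\<close> below, each truncated integral converges absolutely and the
  limit exists, so no default value of \<^const>\<open>Lim\<close> or of the integral is involved.
\<close>

definition frac_laplacian :: "real \<Rightarrow> (real ^ 'n::finite \<Rightarrow> real) \<Rightarrow> real ^ 'n \<Rightarrow> real" where
  "frac_laplacian s u x =
     frac_const CARD('n) s *
     Lim (at_right 0) (\<lambda>\<epsilon>. LINT y : - ball x \<epsilon> | lebesgue.
       (u x - u y) / norm (x - y) powr (real CARD('n) + 2 * s))"

definition L1_loc :: "(real ^ 'n::finite \<Rightarrow> real) \<Rightarrow> bool" where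
  "L1_loc u \<longleftrightarrow> (\<forall>K. compact K \<longrightarrow> u absolutely_integrable_on K)"

definition Lq_loc :: "real \<Rightarrow> (real ^ 'n::finite \<Rightarrow> real) \<Rightarrow> bool" where
  "Lq_loc q u \<longleftrightarrow> u \<in> borel_measurable lebesgue \<and>
     (\<forall>K. compact K \<longrightarrow> (\<lambda>x. \<bar>u x\<bar> powr q) absolutely_integrable_on K)"

definition L2s :: "real \<Rightarrow> (real ^ 'n::finite \<Rightarrow> real) \<Rightarrow> bool" where
  "L2s s u \<longleftrightarrow> L1_loc u \<and>
     integrable lebesgue (\<lambda>x. \<bar>u x\<bar> / (1 + norm x powr (real CARD('n) + 2 * s)))"

definition positive_classical_supersolution ::
    "real \<Rightarrow> real \<Rightarrow> (real ^ 'n::finite \<Rightarrow> real) \<Rightarrow> bool" where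
  "positive_classical_supersolution s q u \<longleftrightarrow>
     (\<forall>x. u x > 0) \<and> Ck 2 u \<and> L2s s u \<and>
     (\<forall>x. - laplacian u x + frac_laplacian s u x \<ge> u x powr q)"

text \<open>
  Both integrals below converge absolutely under the stated hypotheses: \<open>\<phi>\<close> has compact support
  and $|(-\Delta)^s \varphi(x)| \le C / (1 + |x|^{n+2s})$.
\<close>

definition positive_distributional_supersolution ::
    "real \<Rightarrow> real \<Rightarrow> (real ^ 'n::finite \<Rightarrow> real) \<Rightarrow> bool" where
  "positive_distributional_supersolution s q u \<longleftrightarrow>
     (AE x in lebesgue. u x > 0) \<and> L2s s u \<and> Lq_loc q u \<and>
     (\<forall>\<phi>. test_function \<phi> \<and> (\<forall>x. \<phi> x \<ge> 0) \<longrightarrow>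
        (LINT x | lebesgue. u x * (- laplacian \<phi> x + frac_laplacian s \<phi> x))
          \<ge> (LINT x | lebesgue. u x powr q * \<phi> x))"

end

theory Submission
  imports Defs
begin

text \<open>
  Write \<open>n\<close> for the dimension, \<open>p = n + 2 s\<close> and \<open>L = -\<Delta> + (-\<Delta>)\<^sup>s\<close>.

  \<^bold>\<open>Nonexistence.\<close> Test the inequality with \<open>\<eta>\<^sup>m\<close>, where \<open>\<eta>\<close> is a fixed bump rescaled to the ball of
  radius \<open>R\<close>. Both parts of \<open>L\<close> obey the convexity inequality \<open>L (\<eta>\<^sup>m) \<le> m \<eta>\<^sup>m\<^sup>-\<^sup>1 L \<eta>\<close>, so that
  \<open>L (\<eta>\<^sup>m) \<le> C R\<^sup>-\<^sup>2\<^sup>s \<eta>\<^sup>m\<^sup>-\<^sup>1\<close>: although \<open>(-\<Delta>)\<^sup>s\<close> is nonlocal, the test function contributes a positive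
  amount only inside its support (\<open>cutoff_operator_le\<close>). Once \<open>m\<close> is at least \<open>q / (q - 1)\<close>,
  Young's inequality bounds \<open>\<integral> u\<^sup>q \<eta>\<^sup>m\<close> by a multiple of \<open>R\<close> to the power \<open>n - 2 s q / (q - 1)\<close>, which is
  at most \<open>0\<close> precisely when \<open>q \<le> n / (n - 2 s)\<close>; hence \<open>u\<^sup>q\<close> is integrable. Repeat the estimate on
  the complement of a fixed large ball only: on the ball the factor \<open>R\<^sup>-\<^sup>2\<^sup>s\<close> tends to \<open>0\<close>, and outside
  it the tail of \<open>\<integral> u\<^sup>q\<close> is small. In the limit \<open>\<integral> u\<^sup>q = 0\<close>, which contradicts positivity.

  \<^bold>\<open>Existence.\<close> The supersolution is a multiple of the profile \<open>w(x) = (A + |x|\<^sup>2)\<close> to the power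
  \<open>-\<beta>/2\<close> with \<open>\<beta> = 2 s / (q - 1)\<close>, so that \<open>\<beta> q = \<beta> + 2 s\<close> and, above the critical exponent,
  \<open>0 < \<beta> < n - 2 s\<close>. What has to be shown is that \<open>(-\<Delta>)\<^sup>s w\<close> is bounded below by a multiple of
  \<open>M\<close> to the power \<open>-\<beta> - 2 s\<close>, where \<open>M\<^sup>2 = A + |x|\<^sup>2\<close>, with a constant independent of \<open>A\<close>
  (\<open>truncated_fraclap_profile_lower\<close>). Only points \<open>y\<close> with \<open>|y| < |x|\<close> contribute negatively to the
  integral that defines \<open>(-\<Delta>)\<^sup>s w(x)\<close>. The inversion in the sphere of radius \<open>|x|\<close> carries them to the
  exterior and multiplies the kernel by an explicit factor, and there the positive part dominates
  because of an elementary convexity inequality for the profile (\<open>profile_kelvin_ineq\<close>). The term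
  \<open>-\<Delta> w\<close> may be negative when \<open>\<beta> > n - 2\<close>, but it is at least a negative multiple of \<open>M\<close> to the power
  \<open>-\<beta> - 2\<close>, and this is absorbed by choosing \<open>A\<close> large. A small multiple of \<open>w\<close> then satisfies the
  inequality with the power \<open>q\<close>.

  The inversion formula and the radial integrals come from the behaviour of Lebesgue measure on sectors
  of balls under scaling.
\<close>

section \<open>Smooth functions on Euclidean space\<close>

lemma partial_derivative_eq:
  assumes "(u has_derivative D) (at x)"
  shows "partial_derivative i u x = D (axis i 1)"
  using frechet_derivative_at[OF assms] by (simp add: partial_derivative_def)

lemma Ck_SucD:
  fixes u :: "real ^ 'n::finite \<Rightarrow> real"
  shows "Ck (Suc k) u \<Longrightarrow> Ck k u"
proof (induction k arbitrary: u)
  case 0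
  then show ?case
    by (auto intro!: continuous_at_imp_continuous_on differentiable_imp_continuous_within)
next
  case (Suc k)
  then show ?case by (metis Ck.simps(2))
qed

lemma Ck_const: "Ck k (\<lambda>x :: real ^ 'n::finite. c)"
proof (induction k arbitrary: c)
  case (Suc k)
  have "partial_derivative i (\<lambda>x :: real ^ 'n. c) = (\<lambda>x. 0)" for i
    by (rule ext, subst partial_derivative_eq, rule has_derivative_const) simp
  then show ?case using Suc by simp
qed auto

lemma partial_derivative_add:
  assumes "u differentiable (at x)" "v differentiable (at x)"
  shows "partial_derivative i (\<lambda>x. u x + v x) x = partial_derivative i u x + partial_derivative i v x"
  unfolding partial_derivative_def
  using frechet_derivative_at[OF has_derivative_add[OF assms[unfolded frechet_derivative_works]], symmetric]
  by simp

lemma partial_derivative_mult: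
  assumes "u differentiable (at x)" "v differentiable (at x)"
  shows "partial_derivative i (\<lambda>x. u x * v x) x
    = u x * partial_derivative i v x + partial_derivative i u x * v x"
  unfolding partial_derivative_def
  using frechet_derivative_at[OF has_derivative_mult[OF assms[unfolded frechet_derivative_works]], symmetric]
  by simp

lemma partial_derivative_compose:
  assumes "v differentiable (at x)" "(g has_real_derivative g') (at (v x))"
  shows "partial_derivative i (\<lambda>x. g (v x)) x = g' * partial_derivative i v x"
proof -
  have "((\<lambda>x. g (v x)) has_derivative (\<lambda>h. g' * frechet_derivative v (at x) h)) (at x)"
    using diff_chain_at[OF assms(1)[unfolded frechet_derivative_works]
        assms(2)[unfolded has_field_derivative_def]] by (simp add: o_def)
  then show ?thesis
    unfolding partial_derivative_def by (subst frechet_derivative_at[symmetric]) auto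
qed

lemma Ck_add:
  fixes u v :: "real ^ 'n::finite \<Rightarrow> real"
  shows "Ck k u \<Longrightarrow> Ck k v \<Longrightarrow> Ck k (\<lambda>x. u x + v x)"
proof (induction k arbitrary: u v)
  case 0
  then show ?case by (auto intro: continuous_intros)
next
  case (Suc k)
  have "partial_derivative i (\<lambda>x. u x + v x)
      = (\<lambda>x. partial_derivative i u x + partial_derivative i v x)" for i
    using Suc.prems by (auto intro!: ext partial_derivative_add)
  then show ?case using Suc by (auto intro: differentiable_add)
qed

lemma Ck_mult:
  fixes u v :: "real ^ 'n::finite \<Rightarrow> real"
  shows "Ck k u \<Longrightarrow> Ck k v \<Longrightarrow> Ck k (\<lambda>x. u x * v x)"
proof (induction k arbitrary: u v)
  case 0
  then show ?case by (auto intro: continuous_intros)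
next
  case (Suc k)
  have "partial_derivative i (\<lambda>x. u x * v x)
      = (\<lambda>x. u x * partial_derivative i v x + partial_derivative i u x * v x)" for i
    using Suc.prems by (auto intro!: ext partial_derivative_mult)
  moreover have "Ck k u" "Ck k v" using Suc.prems Ck_SucD by blast+
  ultimately show ?case using Suc
    by (auto intro!: Ck_add differentiable_mult)
qed

lemma smooth_fun_power: "smooth_fun u \<Longrightarrow> smooth_fun (\<lambda>x. u x ^ m)"
  by (induction m) (auto simp: smooth_fun_def Ck_const Ck_mult)

text \<open>
  Iterated derivatives of \<open>g (v x)\<close> stay within reach as long as \<open>g\<close> ranges over a family of functions
  of one variable that is closed under differentiation. The two instances are the powers, for the
  profile, and the functions \<open>flat_fun P\<close>, for the bump.
\<close>
lemma smooth_fun_compose: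
  fixes v :: "real ^ 'n::finite \<Rightarrow> real"
  assumes F: "\<And>g. g \<in> F \<Longrightarrow> \<exists>g'\<in>F. \<forall>t\<in>S. (g has_real_derivative g' t) (at t)"
    and v: "smooth_fun v" "\<And>x. v x \<in> S" and g: "g \<in> F"
  shows "smooth_fun (\<lambda>x. g (v x))"
proof -
  have v_diff: "v differentiable (at x)" for x
    using v(1) by (auto simp: smooth_fun_def dest: spec[of _ "Suc 0"])
  have g_diff: "(\<lambda>x. g (v x)) differentiable (at x)" if gF: "g \<in> F" for g x
  proof -
    obtain g' where "\<forall>t\<in>S. (g has_real_derivative g' t) (at t)" using F gF by blast
    then have "g differentiable (at (v x))" using v(2) real_differentiable_def by blast
    then show ?thesis using differentiable_chain_at[OF v_diff, of g] by (simp add: o_def)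
  qed
  have "Ck k (\<lambda>x. g (v x))" if "g \<in> F" for k g
    using that
  proof (induction k arbitrary: g)
    case 0
    then show ?case
      using g_diff by (auto intro!: continuous_at_imp_continuous_on differentiable_imp_continuous_within)
  next
    case (Suc k)
    obtain g' where g': "g' \<in> F" "\<forall>t\<in>S. (g has_real_derivative g' t) (at t)"
      using F Suc.prems by blast
    have "partial_derivative i (\<lambda>x. g (v x)) = (\<lambda>x. g' (v x) * partial_derivative i v x)" for i
      using g' v by (auto intro!: ext partial_derivative_compose v_diff)
    moreover have "Ck k (partial_derivative i v)" for i
      using v(1) by (auto simp: smooth_fun_def dest: spec[of _ "Suc k"])
    ultimately show ?case using Suc g_diff g' by (auto intro!: Ck_mult)
  qed
  then show ?thesis using g by (simp add: smooth_fun_def)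
qed

lemma has_derivative_quadratic:
  fixes x :: "real ^ 'n::finite"
  shows "((\<lambda>x. a + b * (x \<bullet> x)) has_derivative (\<lambda>h. b * (2 * (x \<bullet> h)))) (at x)"
  by (auto intro!: derivative_eq_intros ext simp: inner_commute)

lemma partial_derivative_quadratic:
  "partial_derivative i (\<lambda>x :: real ^ 'n::finite. a + b * (x \<bullet> x)) x = 2 * b * x $ i"
  by (subst partial_derivative_eq[OF has_derivative_quadratic]) (simp add: inner_axis)

lemma partial_derivative_coordinate:
  "partial_derivative j (\<lambda>x :: real ^ 'n::finite. c * x $ i) x = (if i = j then c else 0)"
  by (subst partial_derivative_eq[where D = "\<lambda>h. c * h $ i"])
     (auto intro!: derivative_eq_intros bounded_linear.has_derivative[OF bounded_linear_vec_nth] simp: axis_def)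

lemma smooth_fun_quadratic: "smooth_fun (\<lambda>x :: real ^ 'n::finite. a + b * (x \<bullet> x))"
proof -
  have lin: "Ck k (\<lambda>x :: real ^ 'n. c * x $ i)" for k c i
  proof (cases k)
    case 0
    then show ?thesis by (auto intro!: continuous_intros)
  next
    case (Suc l)
    have "partial_derivative j (\<lambda>x :: real ^ 'n. c * x $ i) = (\<lambda>x. if i = j then c else 0)" for j
      by (rule ext) (simp add: partial_derivative_coordinate)
    moreover have "(\<lambda>x :: real ^ 'n. c * x $ i) differentiable at x" for x
      by (auto intro!: differentiable_mult bounded_linear_imp_differentiable bounded_linear_vec_nth)
    ultimately show ?thesis unfolding Suc by (auto simp: Ck_const)
  qed
  have "Ck k (\<lambda>x :: real ^ 'n. a + b * (x \<bullet> x))" for k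
  proof (cases k)
    case 0
    then show ?thesis by (auto intro!: continuous_intros)
  next
    case (Suc l)
    have "partial_derivative j (\<lambda>x :: real ^ 'n. a + b * (x \<bullet> x)) = (\<lambda>x. (2 * b) * x $ j)" for j
      by (rule ext) (simp add: partial_derivative_quadratic)
    then show ?thesis
      unfolding Suc using lin has_derivative_quadratic[of a b]
      by (auto simp: differentiable_def intro!: exI[of _ "\<lambda>h. b * (2 * (_ \<bullet> h))"])
  qed
  then show ?thesis by (simp add: smooth_fun_def)
qed

lemma partial_derivative_scale:
  fixes u :: "real ^ 'n::finite \<Rightarrow> real"
  assumes "u differentiable (at (c *\<^sub>R x))"
  shows "partial_derivative i (\<lambda>x. u (c *\<^sub>R x)) x = c * partial_derivative i u (c *\<^sub>R x)"
    and "(\<lambda>x. u (c *\<^sub>R x)) differentiable (at x)"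
proof -
  let ?D = "frechet_derivative u (at (c *\<^sub>R x))"
  have 1: "(u has_derivative ?D) (at (c *\<^sub>R x))" using assms frechet_derivative_works by blast
  have 2: "((\<lambda>x. u (c *\<^sub>R x)) has_derivative (\<lambda>h. ?D (c *\<^sub>R h))) (at x)"
    using diff_chain_at[of "\<lambda>x. c *\<^sub>R x" "\<lambda>h. c *\<^sub>R h" x u ?D] 1
    by (simp add: o_def has_derivative_scaleR_right)
  have "linear ?D" using 1 has_derivative_linear by blast
  then show "partial_derivative i (\<lambda>x. u (c *\<^sub>R x)) x = c * partial_derivative i u (c *\<^sub>R x)"
    using partial_derivative_eq[OF 2] by (simp add: partial_derivative_def linear_cmul)
  show "(\<lambda>x. u (c *\<^sub>R x)) differentiable (at x)" using 2 by (auto simp: differentiable_def)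
qed

lemma smooth_fun_differentiable:
  assumes "smooth_fun u" shows "u differentiable (at x)"
    and "smooth_fun (partial_derivative i u)"
proof -
  have "Ck (Suc k) u" for k using assms unfolding smooth_fun_def by blast
  then show "u differentiable (at x)" "smooth_fun (partial_derivative i u)"
    by (auto simp: smooth_fun_def)
qed

lemma smooth_fun_scale:
  fixes u :: "real ^ 'n::finite \<Rightarrow> real"
  assumes "smooth_fun u"
  shows "smooth_fun (\<lambda>x. u (c *\<^sub>R x))"
proof -
  have "Ck k (\<lambda>x. u (c *\<^sub>R x))" for k using assms
  proof (induction k arbitrary: u)
    case 0
    then have "continuous_on UNIV u" by (auto simp: smooth_fun_def dest: spec[of _ 0])
    then show ?case by (auto intro!: continuous_intros continuous_on_compose2[of UNIV u])
  next
    case (Suc k)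
    note d = smooth_fun_differentiable[OF Suc.prems]
    have "partial_derivative i (\<lambda>x. u (c *\<^sub>R x)) = (\<lambda>x. c * partial_derivative i u (c *\<^sub>R x))" for i
      using d by (auto intro!: ext partial_derivative_scale)
    then show ?case using Suc.IH d by (auto intro!: Ck_mult Ck_const partial_derivative_scale(2))
  qed
  then show ?thesis by (simp add: smooth_fun_def)
qed

lemma smooth_fun_continuous: "smooth_fun u \<Longrightarrow> continuous_on S u"
  by (rule continuous_on_subset[of UNIV]) (auto simp: smooth_fun_def dest: spec[of _ 0])

lemma laplacian_scale:
  assumes "smooth_fun u"
  shows "laplacian (\<lambda>x. u (c *\<^sub>R x)) x = c\<^sup>2 * laplacian u (c *\<^sub>R x)"
proof -
  note d = smooth_fun_differentiable[OF assms]
  have "partial_derivative i (\<lambda>x. u (c *\<^sub>R x)) = (\<lambda>x. c * partial_derivative i u (c *\<^sub>R x))" for i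
    using d by (auto intro!: ext partial_derivative_scale)
  moreover have "partial_derivative i (\<lambda>x. c * partial_derivative i u (c *\<^sub>R x)) x
      = c\<^sup>2 * partial_derivative i (partial_derivative i u) (c *\<^sub>R x)" for i
    using d(2)[of i, THEN smooth_fun_differentiable(1)] 
    by (subst partial_derivative_mult)
       (auto simp: partial_derivative_scale power2_eq_square partial_derivative_eq[OF has_derivative_const])
  ultimately show ?thesis by (simp add: laplacian_def sum_distrib_left)
qed

lemma laplacian_compose:
  fixes v :: "real ^ 'n::finite \<Rightarrow> real"
  assumes v: "smooth_fun v" "\<And>x. v x \<in> S"
    and g: "\<And>t. t \<in> S \<Longrightarrow> (g has_real_derivative g' t) (at t)"
      "\<And>t. t \<in> S \<Longrightarrow> (g' has_real_derivative g'' t) (at t)"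
  shows "laplacian (\<lambda>x. g (v x)) x
    = g' (v x) * laplacian v x + g'' (v x) * (\<Sum>i\<in>UNIV. (partial_derivative i v x)\<^sup>2)"
proof -
  note d = smooth_fun_differentiable[OF v(1)]
  have "partial_derivative i (\<lambda>x. g (v x)) = (\<lambda>x. g' (v x) * partial_derivative i v x)" for i
    using d g v by (auto intro!: ext partial_derivative_compose)
  moreover have "partial_derivative i (\<lambda>x. g' (v x) * partial_derivative i v x) x
      = g' (v x) * partial_derivative i (partial_derivative i v) x
        + g'' (v x) * (partial_derivative i v x)\<^sup>2" for i
  proof -
    have "(\<lambda>x. g' (v x)) differentiable (at x)"
      using g(2)[OF v(2)[of x]] d(1)[of x] differentiable_chain_at[of v x g']
      by (auto simp: o_def real_differentiable_def)
    then show ?thesis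
      using d(2)[of i, THEN smooth_fun_differentiable(1)] d(1) g(2) v(2)
      by (simp add: partial_derivative_mult partial_derivative_compose power2_eq_square)
  qed
  ultimately show ?thesis by (simp add: laplacian_def sum_distrib_left sum.distrib)
qed

lemma has_derivative_partials:
  assumes "u differentiable (at (x :: real ^ 'n::finite))"
  shows "(u has_derivative (\<lambda>h. \<Sum>i\<in>UNIV. h $ i * partial_derivative i u x)) (at x)"
proof -
  have D: "(u has_derivative frechet_derivative u (at x)) (at x)"
    using assms frechet_derivative_works by blast
  have "frechet_derivative u (at x) h = (\<Sum>i\<in>UNIV. h $ i * partial_derivative i u x)" for h
  proof -
    have "h = (\<Sum>i\<in>UNIV. h $ i *\<^sub>R axis i 1)"
      using basis_expansion[of h] by (simp add: scalar_mult_eq_scaleR)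
    then have "frechet_derivative u (at x) h = frechet_derivative u (at x) (\<Sum>i\<in>UNIV. h $ i *\<^sub>R axis i 1)"
      by simp
    also have "\<dots> = (\<Sum>i\<in>UNIV. h $ i * partial_derivative i u x)"
      using has_derivative_linear[OF D]
      by (simp add: linear_sum linear_cmul partial_derivative_def)
    finally show ?thesis .
  qed
  then show ?thesis using D by (metis (no_types, lifting) ext)
qed

text \<open>
  Along the segment from \<open>x - h\<close> to \<open>x + h\<close> the second difference is, by two applications of the mean
  value theorem, a multiple of a second derivative in the direction \<open>h\<close>.
\<close>
lemma second_difference_le:
  fixes u :: "real ^ 'n::finite \<Rightarrow> real"
  assumes u: "smooth_fun u"
    and K: "\<And>z i j. z \<in> cball x r \<Longrightarrow> \<bar>partial_derivative j (partial_derivative i u) z\<bar> \<le> K"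
    and h: "norm h \<le> r"
  shows "\<bar>2 * u x - u (x + h) - u (x - h)\<bar> \<le> 2 * (real CARD('n))\<^sup>2 * K * (norm h)\<^sup>2"
proof -
  note d = smooth_fun_differentiable[OF u]
  define g1 where "g1 t = (\<Sum>i\<in>UNIV. h $ i * partial_derivative i u (x + t *\<^sub>R h))" for t
  define g2 where "g2 t = (\<Sum>i\<in>UNIV. h $ i * (\<Sum>j\<in>UNIV. h $ j *
      partial_derivative j (partial_derivative i u) (x + t *\<^sub>R h)))" for t
  have line: "((\<lambda>t. f (x + t *\<^sub>R h)) has_real_derivative
      (\<Sum>i\<in>UNIV. h $ i * partial_derivative i f (x + t *\<^sub>R h))) (at t)"
    if "smooth_fun f" for f t
  proof -
    have "((\<lambda>t. x + t *\<^sub>R h) has_derivative (\<lambda>t. t *\<^sub>R h)) (at t)"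
      by (auto intro!: derivative_eq_intros)
    from diff_chain_at[OF this has_derivative_partials[OF smooth_fun_differentiable(1)[OF that]]]
    have "((\<lambda>t. f (x + t *\<^sub>R h)) has_derivative
        (\<lambda>d. (\<Sum>i\<in>UNIV. h $ i * partial_derivative i f (x + t *\<^sub>R h)) * d)) (at t)"
      by (simp add: o_def sum_distrib_left mult_ac)
    then show ?thesis by (simp add: has_field_derivative_def)
  qed
  have g: "((\<lambda>t. u (x + t *\<^sub>R h)) has_real_derivative g1 t) (at t)" for t
    unfolding g1_def by (rule line[OF u])
  have g1: "(g1 has_real_derivative g2 t) (at t)" for t
    unfolding g1_def[abs_def] g2_def by (intro DERIV_sum DERIV_cmult line d)
  have "\<exists>z>0. z < 1 \<and> (u (x + 1 *\<^sub>R h) + u (x + (-1) *\<^sub>R h))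
      - (u (x + 0 *\<^sub>R h) + u (x + (-0) *\<^sub>R h)) = (1 - 0) * (g1 z - g1 (- z))"
  proof (rule MVT2[of 0 1 "\<lambda>t. u (x + t *\<^sub>R h) + u (x + (- t) *\<^sub>R h)" "\<lambda>t. g1 t - g1 (- t)"])
    fix t :: real
    show "((\<lambda>t. u (x + t *\<^sub>R h) + u (x + (- t) *\<^sub>R h)) has_real_derivative g1 t - g1 (- t)) (at t)"
    proof (rule DERIV_cong[OF DERIV_add[OF g[of t]]])
      show "((\<lambda>t. u (x + (- t) *\<^sub>R h)) has_real_derivative g1 (- t) * (-1)) (at t)"
        by (rule DERIV_chain2[where f = "\<lambda>t. u (x + t *\<^sub>R h)" and g = uminus, OF g])
           (auto intro!: derivative_eq_intros)
    qed simp
  qed simp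
  then obtain z where z: "0 < z" "z < 1"
    "(u (x + h) + u (x - h)) - 2 * u x = g1 z - g1 (- z)" by auto
  obtain w where w: "- z < w" "w < z" "g1 z - g1 (- z) = (z - (- z)) * g2 w"
    using MVT2[of "- z" z g1 g2] g1 z(1) by auto
  have "\<bar>g2 w\<bar> \<le> (\<Sum>i\<in>(UNIV :: 'n set). \<Sum>j\<in>(UNIV :: 'n set). norm h * (norm h * K))"
  proof -
    have "norm (w *\<^sub>R h) \<le> 1 * r" unfolding norm_scaleR
      using w z h by (intro mult_mono) auto
    then have in_ball: "x + w *\<^sub>R h \<in> cball x r" by (simp add: dist_norm)
    have "\<bar>h $ i * (h $ j * partial_derivative j (partial_derivative i u) (x + w *\<^sub>R h))\<bar>
        \<le> norm h * (norm h * K)" for i j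
      unfolding abs_mult using K[OF in_ball, of j i]
      by (intro mult_mono component_le_norm_cart) auto
    then show ?thesis unfolding g2_def sum_distrib_left
      by (intro order_trans[OF sum_abs] sum_mono order_trans[OF sum_abs]) auto
  qed
  then have "\<bar>g2 w\<bar> \<le> (real CARD('n))\<^sup>2 * K * (norm h)\<^sup>2"
    by (simp add: power2_eq_square mult_ac)
  moreover have "\<bar>2 * u x - u (x + h) - u (x - h)\<bar> = (2 * z) * \<bar>g2 w\<bar>"
  proof -
    have "2 * u x - u (x + h) - u (x - h) = - ((2 * z) * g2 w)" using z w by simp
    then show ?thesis using z(1) by (simp only: abs_minus_cancel abs_mult)
  qed
  moreover have "(2 * z) * \<bar>g2 w\<bar> \<le> 2 * \<bar>g2 w\<bar>" using z by (intro mult_right_mono) auto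
  ultimately show ?thesis by linarith
qed

section \<open>Radial integrals and inversion in a sphere\<close>

lemma nn_integral_lborel_scale:
  fixes f :: "'a::euclidean_space \<Rightarrow> ennreal"
  assumes c: "c > 0" and [measurable]: "f \<in> borel_measurable borel"
  shows "(\<integral>\<^sup>+x. f x \<partial>lborel) = ennreal (c ^ DIM('a)) * (\<integral>\<^sup>+x. f (c *\<^sub>R x) \<partial>lborel)"
proof -
  let ?N = "density (distr lborel borel (\<lambda>x::'a. c *\<^sub>R x)) (\<lambda>_. ennreal (c ^ DIM('a)))"
  have N: "lborel = ?N" using lborel_affine[of c "0 :: 'a"] c by simp
  have "(\<integral>\<^sup>+x. f x \<partial>lborel) = (\<integral>\<^sup>+x. f x \<partial>?N)"
    using arg_cong[OF N, of "\<lambda>M. nn_integral M f"] .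
  also have "\<dots> = (\<integral>\<^sup>+x. ennreal (c ^ DIM('a)) * f (c *\<^sub>R x) \<partial>lborel)"
    by (subst nn_integral_density, measurable, subst nn_integral_distr, measurable)
  also have "\<dots> = ennreal (c ^ DIM('a)) * (\<integral>\<^sup>+x. f (c *\<^sub>R x) \<partial>lborel)"
    by (intro nn_integral_cmult) measurable
  finally show ?thesis .
qed

text \<open>
  For \<open>x \<noteq> 0\<close> the vector \<open>sgn x\<close> is the direction of \<open>x\<close>, so these are the sectors of the ball of radius
  \<open>r\<close> cut out by a set \<open>B\<close> of directions. Polar coordinates enter only through their measures.
\<close>
abbreviation sector :: "'a::euclidean_space set \<Rightarrow> real \<Rightarrow> 'a set" where
  "sector B r \<equiv> {x. norm x \<le> r \<and> sgn x \<in> B}"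

lemma measurable_sgn_vec [measurable]: "(sgn :: 'a::euclidean_space \<Rightarrow> 'a) \<in> borel_measurable borel"
proof -
  have "(\<lambda>x::'a. inverse (norm x) *\<^sub>R x) \<in> borel_measurable borel" by measurable
  then show ?thesis by (simp only: sgn_div_norm[abs_def])
qed

lemma sets_sector [measurable, simp]:
  assumes [measurable]: "B \<in> sets borel" shows "sector B r \<in> sets borel"
proof -
  have "sgn -` B \<inter> space borel \<in> sets borel"
    by (rule measurable_sets[OF measurable_sgn_vec assms])
  moreover have "sector B r = (sgn -` B \<inter> space borel) \<inter> cball 0 r" by auto
  ultimately show ?thesis by (metis borel_closed closed_cball sets.Int)
qed

lemma emeasure_sector:
  fixes B :: "'a::euclidean_space set"
  assumes [measurable]: "B \<in> sets borel" and "r \<ge> 0"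
  shows "emeasure lborel (sector B r) = ennreal (r ^ DIM('a)) * emeasure lborel (sector B 1)"
proof (cases "r = 0")
  case True
  have "emeasure lborel (sector B 0) \<le> emeasure lborel {0 :: 'a}"
    by (intro emeasure_mono) auto
  then show ?thesis using True by (simp add: zero_power)
next
  case False
  then have r: "r > 0" using assms by simp
  have "indicator (sector B r) (r *\<^sub>R x) = (indicator (sector B 1) x :: ennreal)" for x :: 'a
    using r by (auto simp: indicator_def sgn_scaleR)
  then show ?thesis
    using nn_integral_lborel_scale[OF r, of "indicator (sector B r)"] by simp
qed

lemma emeasure_sector_finite:
  fixes B :: "'a::euclidean_space set"
  shows "emeasure lborel (sector B r) < \<infinity>"
proof -
  have "emeasure lborel (sector B r) \<le> emeasure lborel (cball (0 :: 'a) r)"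
    by (intro emeasure_mono) auto
  then show ?thesis using emeasure_lborel_cball_finite[of "0 :: 'a" r] by (simp add: order.strict_trans1)
qed

text \<open>
  By scaling, the sector of radius \<open>r\<close> has measure \<open>r\<^sup>n\<close> times that of the unit sector. Hence the
  distribution of \<open>norm\<close> on the cone over \<open>B\<close> has density proportional to \<open>n r\<^sup>n\<^sup>-\<^sup>1\<close>, since the two
  measures on the line agree on all half-lines.
\<close>
lemma nn_integral_radial_sector:
  fixes B :: "'a::euclidean_space set" and g :: "real \<Rightarrow> ennreal"
  assumes B [measurable]: "B \<in> sets borel" and [measurable]: "g \<in> borel_measurable borel"
  shows "(\<integral>\<^sup>+x. indicator B (sgn x) * g (norm x) \<partial>lborel) =
    emeasure lborel (sector B 1) *
    (\<integral>\<^sup>+r. ennreal (DIM('a) * r ^ (DIM('a) - 1)) * indicator {0..} r * g r \<partial>lborel)"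
proof -
  let ?n = "DIM('a)" and ?\<sigma> = "emeasure lborel (sector B 1)"
  define d where "d r = ?\<sigma> * (ennreal (?n * r ^ (?n - 1)) * indicator {0..} r)" for r :: real
  have [measurable]: "d \<in> borel_measurable borel" unfolding d_def by measurable
  let ?M = "distr (density lborel (\<lambda>x. indicator B (sgn x))) borel norm"
  have "?M = density lborel d"
  proof (rule measure_eqI_generator_eq)
    show "Int_stable (range (\<lambda>a::real. {..a}))" by (auto simp: Int_stable_def)
    show "sets ?M = sigma_sets UNIV (range atMost)" "sets (density lborel d) = sigma_sets UNIV (range atMost)"
      using borel_eq_atMost[where 'a=real] by (simp_all add: borel_eq_atMost sets_measure_of)
    have M: "emeasure ?M {..r} = emeasure lborel (sector B r)" for r
    proof -
      have "emeasure ?M {..r} = (\<integral>\<^sup>+x. indicator B (sgn x) * indicator (norm -` {..r}) x \<partial>lborel)"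
        by (simp add: emeasure_distr emeasure_density vimage_def)
      also have "\<dots> = (\<integral>\<^sup>+x. indicator (sector B r) x \<partial>lborel)"
        by (intro nn_integral_cong) (auto simp: indicator_def)
      finally show ?thesis by simp
    qed
    have N: "emeasure (density lborel d) {..r} = (if r \<ge> 0 then ?\<sigma> * ennreal (r ^ ?n) else 0)" for r
    proof -
      have "emeasure (density lborel d) {..r}
          = (\<integral>\<^sup>+t. ?\<sigma> * (ennreal (?n * t ^ (?n - 1)) * indicator {0..r} t) \<partial>lborel)"
        unfolding d_def
        by (subst emeasure_density) (auto intro!: nn_integral_cong simp: indicator_def)
      also have "\<dots> = ?\<sigma> * (\<integral>\<^sup>+t. ennreal (?n * t ^ (?n - 1)) * indicator {0..r} t \<partial>lborel)"
        by (intro nn_integral_cmult) measurable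
      also have "(\<integral>\<^sup>+t. ennreal (?n * t ^ (?n - 1)) * indicator {0..r} t \<partial>lborel) = ennreal (r ^ ?n - 0 ^ ?n)"
        if "r \<ge> 0"
        using that by (intro nn_integral_FTC_Icc[where F = "\<lambda>t. t ^ ?n"])
          (auto intro!: derivative_eq_intros)
      ultimately show ?thesis by (auto simp: zero_power)
    qed
    show "emeasure ?M X = emeasure (density lborel d) X" if X: "X \<in> range atMost" for X
    proof -
      obtain r where r: "X = {..r}" using X by auto
      show ?thesis
      proof (cases "r \<ge> 0")
        case True
        then show ?thesis unfolding r M N using emeasure_sector[OF B True] by (simp add: mult.commute)
      next
        case False
        then have "sector B r = {}" using norm_ge_zero order_trans by (auto simp del: norm_ge_zero) 
        then have "emeasure lborel (sector B r) = 0" by (simp only: emeasure_empty)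
        then show ?thesis unfolding r M N using False by simp
      qed
    qed
    show "range (\<lambda>k::nat. {..real k}) \<subseteq> range atMost" by auto
    show "(\<Union>k::nat. {..real k}) = UNIV" by (auto simp: real_arch_simple)
    show "emeasure ?M {..real k} \<noteq> \<infinity>" for k :: nat
      unfolding M using emeasure_sector_finite[of "real k" B] by simp
  qed auto
  have "(\<integral>\<^sup>+x. indicator B (sgn x) * g (norm x) \<partial>lborel) = (\<integral>\<^sup>+r. g r \<partial>?M)"
    by (simp add: nn_integral_distr nn_integral_density)
  also have "\<dots> = (\<integral>\<^sup>+r. d r * g r \<partial>lborel)"
    unfolding \<open>?M = density lborel d\<close> by (simp add: nn_integral_density)
  also have "\<dots> = ?\<sigma> * (\<integral>\<^sup>+r. ennreal (?n * r ^ (?n - 1)) * indicator {0..} r * g r \<partial>lborel)"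
    unfolding d_def by (simp add: mult.assoc nn_integral_cmult)
  finally show ?thesis .
qed

text \<open>
  Sectors form an intersection-stable class, and they generate the Borel sets because both \<open>norm\<close> and
  \<open>sgn\<close> are measurable for the generated sigma-algebra and \<open>x = norm x *\<^sub>R sgn x\<close>.
\<close>
lemma measure_eqI_sector:
  fixes M N :: "'a::euclidean_space measure"
  assumes M: "sets M = sets borel" and N: "sets N = sets borel"
    and eq: "\<And>B r. B \<in> sets borel \<Longrightarrow> emeasure M (sector B r) = emeasure N (sector B r)"
    and fin: "\<And>r. emeasure M (sector UNIV r) < \<infinity>"
  shows "M = N"
proof -
  define E where "E = {sector B r :: 'a set | B r. B \<in> sets borel}"
  have E: "sector B r \<in> E" if "B \<in> sets borel" for B r using that by (auto simp: E_def)
  let ?S = "sigma UNIV E"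
  have in_S: "sector B r \<in> sets ?S" if "B \<in> sets borel" for B r using E[OF that] by auto
  have [measurable]: "norm \<in> borel_measurable ?S"
  proof (rule borel_measurableI_le)
    show "{x \<in> space ?S. norm x \<le> y} \<in> sets ?S" for y using in_S[of UNIV y] by simp
  qed
  have [measurable]: "sgn \<in> borel_measurable ?S"
  proof (rule measurableI)
    fix B :: "'a set" assume B: "B \<in> sets borel"
    have "sgn -` B \<inter> space ?S = (\<Union>k::nat. sector B (real k))"
      by (auto simp: real_arch_simple)
    moreover have "(\<Union>k::nat. sector B (real k)) \<in> sets ?S"
      by (rule sets.countable_nat_UN, rule image_subsetI, rule in_S, rule B)
    ultimately show "sgn -` B \<inter> space ?S \<in> sets ?S" by metis
  qed simp
  have "(\<lambda>x. norm x *\<^sub>R sgn x) \<in> borel_measurable ?S" by measurable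
  then have id: "(\<lambda>x::'a. x) \<in> borel_measurable ?S"
    by (simp add: sgn_div_norm) (metis (no_types, lifting) ext norm_eq_zero right_inverse scale_zero_right scaleR_one)
  have "sets borel = sigma_sets UNIV E"
  proof
    show "sets borel \<subseteq> sigma_sets UNIV E"
    proof
      fix B :: "'a set" assume "B \<in> sets borel"
      from measurable_sets[OF id this] show "B \<in> sigma_sets UNIV E" by simp
    qed
    show "sigma_sets UNIV E \<subseteq> sets borel"
      by (rule sets.sigma_sets_subset[of _ "borel :: 'a measure", simplified]) (auto simp: E_def)
  qed
  show ?thesis
  proof (rule measure_eqI_generator_eq[where E = E and \<Omega> = UNIV and A = "\<lambda>k::nat. sector UNIV (real k)"])
    show "Int_stable E"
    proof (rule Int_stableI)
      fix X Y assume "X \<in> E" "Y \<in> E"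
      then obtain B r B' r' where "X = sector B r" "Y = sector B' r'" "B \<in> sets borel" "B' \<in> sets borel"
        by (auto simp: E_def)
      then have "X \<inter> Y = sector (B \<inter> B') (min r r')" "B \<inter> B' \<in> sets borel" by auto
      then show "X \<inter> Y \<in> E" using E by metis
    qed
    show "(\<Union>k::nat. sector UNIV (real k)) = (UNIV :: 'a set)" by (auto simp: real_arch_simple)
    show "emeasure M (sector UNIV (real k)) \<noteq> \<infinity>" for k using fin[of "real k"] by simp
    show "sets M = sigma_sets UNIV E" "sets N = sigma_sets UNIV E"
      using M N \<open>sets borel = sigma_sets UNIV E\<close> by simp_all
    show "emeasure M X = emeasure N X" if "X \<in> E" for X
      using that eq unfolding E_def by blast
    show "range (\<lambda>k::nat. sector UNIV (real k)) \<subseteq> E"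
      by (rule image_subsetI, rule E) simp
  qed simp
qed

text \<open>
  The substitution \<open>y = \<rho>\<^sup>2 z / |z|\<^sup>2\<close>, whose Jacobian has absolute value \<open>(\<rho> / |z|)\<close> to the power \<open>2 n\<close>. The
  inversion preserves directions and turns the sector \<open>|y| \<le> r\<close> into the exterior region
  \<open>|z| \<ge> \<rho>\<^sup>2 / r\<close>, so that comparing measures of sectors reduces the claim to a one-dimensional
  integral of a power.
\<close>
lemma nn_integral_inversion:
  fixes f :: "'a::euclidean_space \<Rightarrow> ennreal"
  assumes \<rho>: "\<rho> > 0" and [measurable]: "f \<in> borel_measurable borel"
  shows "(\<integral>\<^sup>+y. f y \<partial>lborel) =
    (\<integral>\<^sup>+z. ennreal ((\<rho> / norm z) ^ (2 * DIM('a))) * f ((\<rho> / norm z)\<^sup>2 *\<^sub>R z) \<partial>lborel)"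
proof -
  let ?n = "DIM('a)"
  define J where "J z = (\<rho> / norm z)\<^sup>2 *\<^sub>R z" for z :: 'a
  define w where "w t = ennreal ((\<rho> / t) ^ (2 * ?n))" for t :: real
  have [measurable]: "J \<in> borel_measurable borel" "w \<in> borel_measurable borel"
    unfolding J_def[abs_def] w_def[abs_def] by measurable
  have nz: "AE z::'a in lborel. z \<noteq> 0"
    using AE_lborel_singleton[of "0::'a"] by auto
  let ?N = "distr (density lborel (\<lambda>z. w (norm z))) borel J"
  have N: "lborel = ?N"
  proof (rule measure_eqI_sector)
    show "emeasure lborel (sector (UNIV :: 'a set) r) < \<infinity>" for r
      by (rule emeasure_sector_finite)
  next
    fix B :: "'a set" and r :: real
    assume B [measurable]: "B \<in> sets borel"
    have N: "emeasure ?N (sector B r) = (\<integral>\<^sup>+z. w (norm z) * indicator (J -` sector B r) z \<partial>lborel)"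
      by (simp add: emeasure_distr emeasure_density)
    show "emeasure lborel (sector B r) = emeasure ?N (sector B r)"
    proof (cases "r > 0")
      case True
      define a where "a = \<rho>\<^sup>2 / r"
      have a: "a > 0" using True \<rho> by (simp add: a_def)
      have J: "J z \<in> sector B r \<longleftrightarrow> norm z \<ge> a \<and> sgn z \<in> B" if "z \<noteq> 0" for z
      proof -
        have "norm (J z) = \<rho>\<^sup>2 / norm z" using that by (simp add: J_def power2_eq_square)
        moreover have "sgn (J z) = sgn z" using that \<rho> by (simp add: J_def sgn_scaleR)
        ultimately show ?thesis using that True by (auto simp: a_def pos_divide_le_eq mult.commute)
      qed
      have "emeasure ?N (sector B r) = (\<integral>\<^sup>+z. indicator B (sgn z) * (w (norm z) * indicator {a..} (norm z)) \<partial>lborel)"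
        unfolding N using nz
      proof (intro nn_integral_cong_AE, elim eventually_mono)
        fix z :: 'a assume "z \<noteq> 0"
        from J[OF this] have "z \<in> J -` sector B r \<longleftrightarrow> norm z \<ge> a \<and> sgn z \<in> B" unfolding vimage_eq .
        then show "w (norm z) * indicator (J -` sector B r) z
            = indicator B (sgn z) * (w (norm z) * indicator {a..} (norm z))"
          by (simp only: indicator_def atLeast_iff) auto
      qed
      also have "\<dots> = emeasure lborel (sector B 1) *
          (\<integral>\<^sup>+t. ennreal (?n * t ^ (?n - 1)) * indicator {0..} t * (w t * indicator {a..} t) \<partial>lborel)"
        by (rule nn_integral_radial_sector) measurable
      also have "(\<integral>\<^sup>+t. ennreal (?n * t ^ (?n - 1)) * indicator {0..} t * (w t * indicator {a..} t) \<partial>lborel)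
          = (\<integral>\<^sup>+t. ennreal (?n * t ^ (?n - 1) * (\<rho> / t) ^ (2 * ?n)) * indicator {a..} t \<partial>lborel)"
        using a by (intro nn_integral_cong) (auto simp: indicator_def w_def ennreal_mult)
      also have "\<dots> = ennreal (0 - (- (\<rho> ^ (2 * ?n) * inverse a ^ ?n)))"
      proof (rule nn_integral_FTC_atLeast)
        fix t assume t: "a \<le> t"
        have "((\<lambda>t. - (\<rho> ^ (2 * ?n) * inverse t ^ ?n)) has_real_derivative
            - (\<rho> ^ (2 * ?n) * (?n * inverse t ^ (?n - 1) * (- (inverse t * 1 * inverse t))))) (at t)"
          using t a by (auto intro!: derivative_eq_intros)
        moreover have "- (\<rho> ^ (2 * ?n) * (?n * inverse t ^ (?n - 1) * (- (inverse t * 1 * inverse t))))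
            = ?n * t ^ (?n - 1) * (\<rho> / t) ^ (2 * ?n)"
        proof -
          obtain m where m: "?n = Suc m" using DIM_positive[where 'a='a] gr0_implies_Suc by blast
          show ?thesis using t a
            by (simp add: m power_divide field_simps power_mult power2_eq_square)
        qed
        ultimately show "((\<lambda>t. - (\<rho> ^ (2 * ?n) * inverse t ^ ?n)) has_real_derivative
            ?n * t ^ (?n - 1) * (\<rho> / t) ^ (2 * ?n)) (at t)" by (simp only:)
        show "0 \<le> ?n * t ^ (?n - 1) * (\<rho> / t) ^ (2 * ?n)" using t a \<rho> by simp
      next
        have "((\<lambda>t. - (\<rho> ^ (2 * ?n) * inverse t ^ ?n)) \<longlongrightarrow> - (\<rho> ^ (2 * ?n) * 0 ^ ?n)) at_top"
          by (intro tendsto_intros tendsto_inverse_0_at_top filterlim_ident)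
        then show "((\<lambda>t. - (\<rho> ^ (2 * ?n) * inverse t ^ ?n)) \<longlongrightarrow> 0) at_top"
          by (simp add: zero_power)
      qed measurable
      also have "0 - (- (\<rho> ^ (2 * ?n) * inverse a ^ ?n)) = r ^ ?n"
        using \<rho> power_mult[of \<rho> 2 ?n] by (simp add: a_def power_divide)
      finally show ?thesis using emeasure_sector[OF B, of r] True by (simp add: mult.commute)
    next
      case False
      then have sub: "sector B r \<subseteq> {0}"
        by (intro subsetI) (metis (mono_tags, lifting) mem_Collect_eq norm_le_zero_iff order_trans not_less singleton_iff)
      have "emeasure lborel (sector B r) \<le> emeasure lborel {0 :: 'a}" by (intro emeasure_mono sub) simp
      moreover have "J z \<notin> sector B r" if "z \<noteq> 0" for z
      proof -
        have "J z \<noteq> 0" using that \<rho> by (simp add: J_def)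
        then show ?thesis using sub by blast
      qed
      then have "(\<integral>\<^sup>+z. w (norm z) * indicator (J -` sector B r) z \<partial>lborel) = (\<integral>\<^sup>+z. 0 \<partial>(lborel :: 'a measure))"
        using nz by (intro nn_integral_cong_AE, elim eventually_mono) (simp only: indicator_def vimage_eq of_bool_eq if_False mult_zero_right simp_thms)
      ultimately show ?thesis unfolding N by simp
    qed
  qed simp_all
  have "(\<integral>\<^sup>+y. f y \<partial>lborel) = (\<integral>\<^sup>+y. f y \<partial>?N)"
    using arg_cong[OF N, of "\<lambda>M. nn_integral M f"] .
  also have "\<dots> = (\<integral>\<^sup>+z. w (norm z) * f (J z) \<partial>lborel)"
    by (subst nn_integral_distr, measurable, subst nn_integral_density, measurable)
  finally show ?thesis unfolding w_def J_def .
qed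

text \<open>
  In polar coordinates the integrand behaves like \<open>r\<close> to the power \<open>1 - 2 s\<close> near \<open>0\<close> and to the power
  \<open>-1 - 2 s\<close> near infinity; this is where \<open>0 < s < 1\<close> enters.
\<close>
lemma integrable_fractional_kernel:
  fixes s :: real
  assumes s: "0 < s" "s < 1"
  shows "integrable lborel (\<lambda>h::'a::euclidean_space. min 1 ((norm h)\<^sup>2) / norm h powr (real DIM('a) + 2 * s))"
proof (rule integrableI_bounded)
  let ?n = "DIM('a)"
  define g where "g r = ennreal (min 1 (r\<^sup>2) / r powr (real ?n + 2 * s))" for r :: real
  have [measurable]: "g \<in> borel_measurable borel" unfolding g_def[abs_def] by measurable
  have "(\<integral>\<^sup>+h. ennreal (norm (min 1 ((norm h)\<^sup>2) / norm h powr (real ?n + 2 * s))) \<partial>(lborel :: 'a measure))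
      = (\<integral>\<^sup>+h. indicator UNIV (sgn h) * g (norm h) \<partial>(lborel :: 'a measure))"
    by (simp add: g_def min_def)
  also have "\<dots> = emeasure lborel (sector (UNIV :: 'a set) 1) *
    (\<integral>\<^sup>+r. ennreal (?n * r ^ (?n - 1)) * indicator {0..} r * g r \<partial>lborel)"
    by (rule nn_integral_radial_sector) measurable
  also have "\<dots> < \<infinity>"
  proof -
    have "(\<integral>\<^sup>+r. ennreal (?n * r ^ (?n - 1)) * indicator {0..} r * g r \<partial>lborel)
      \<le> (\<integral>\<^sup>+r. ennreal ?n * (ennreal (r powr (1 - 2 * s)) * indicator {0..1} r)
            + ennreal ?n * (ennreal (r powr (-1 - 2 * s)) * indicator {1..} r) \<partial>lborel)"
    proof (intro nn_integral_mono)
      fix r :: real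
      have eq: "r ^ (?n - 1) / r powr (real ?n + 2 * s) = r powr (-1 - 2 * s)" if "r > 0"
        using that DIM_positive[where 'a='a]
        by (simp add: powr_realpow[symmetric] powr_diff[symmetric] of_nat_diff del: DIM_positive)
      have le: "ennreal (?n * r ^ (?n - 1)) * g r \<le> ennreal ?n * ennreal (r powr (-1 - 2 * s))" if "r \<ge> 1"
      proof -
        have "ennreal (?n * r ^ (?n - 1)) * g r = ennreal (?n * (r ^ (?n - 1) / r powr (real ?n + 2 * s)))"
          using that by (simp add: g_def ennreal_mult[symmetric] min_def)
        also have "\<dots> = ennreal (?n * r powr (-1 - 2 * s))" using that by (simp only: eq)
        finally show ?thesis using that by (simp add: ennreal_mult)
      qed
      have le': "ennreal (?n * r ^ (?n - 1)) * g r \<le> ennreal ?n * ennreal (r powr (1 - 2 * s))" if "0 < r" "r \<le> 1"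
      proof -
        have "r\<^sup>2 \<le> 1" using that by (simp add: power_le_one)
        then have "ennreal (?n * r ^ (?n - 1)) * g r = ennreal (?n * ((r ^ (?n - 1) / r powr (real ?n + 2 * s)) * r powr 2))"
          using that by (simp add: g_def ennreal_mult[symmetric] min_def)
        also have "\<dots> = ennreal (?n * r powr (1 - 2 * s))"
          using that by (simp only: eq powr_add[symmetric]) simp
        finally show ?thesis using that by (simp add: ennreal_mult)
      qed
      show "ennreal (?n * r ^ (?n - 1)) * indicator {0..} r * g r
        \<le> ennreal ?n * (ennreal (r powr (1 - 2 * s)) * indicator {0..1} r)
            + ennreal ?n * (ennreal (r powr (-1 - 2 * s)) * indicator {1..} r)"
        using le le' by (cases "r > 1"; cases "r = 1"; cases "r > 0") (auto simp: indicator_def g_def add_increasing2 intro: order_trans)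
    qed
    also have "\<dots> = ennreal ?n * (\<integral>\<^sup>+r. ennreal (r powr (1 - 2 * s)) * indicator {0..1} r \<partial>lborel)
      + ennreal ?n * (\<integral>\<^sup>+r. ennreal (r powr (-1 - 2 * s)) * indicator {1..} r \<partial>lborel)"
      by (simp add: nn_integral_add nn_integral_cmult)
    also have "\<dots> = ennreal ?n * ennreal (1 powr (1 - 2 * s + 1) / (1 - 2 * s + 1))
        + ennreal ?n * ennreal (-(1 powr (-1 - 2 * s + 1)) / (-1 - 2 * s + 1))"
      using s by (intro arg_cong2[where f = "(+)"] arg_cong2[where f = "(*)"] refl
          nn_integral_has_integral_lebesgue' has_integral_powr_from_0 has_integral_powr_to_inf) auto
    also have "\<dots> < \<infinity>" by (simp add: ennreal_mult_less_top ennreal_add_eq_top)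
    finally show ?thesis
      using emeasure_sector_finite[of 1 "UNIV :: 'a set"] by (simp add: ennreal_mult_less_top)
  qed
  finally show "(\<integral>\<^sup>+h. ennreal (norm (min 1 ((norm h)\<^sup>2) / norm h powr (real ?n + 2 * s))) \<partial>(lborel :: 'a measure)) < \<infinity>" .
qed measurable

section \<open>The fractional Laplacian as an absolutely convergent integral\<close>

lemma lborel_affine_density:
  fixes t :: "'a::euclidean_space"
  assumes "c \<noteq> 0"
  shows "lborel = density (distr lborel borel (\<lambda>x. t + c *\<^sub>R x)) (\<lambda>_. ennreal (\<bar>c\<bar> ^ DIM('a)))"
  using lborel_affine[OF assms, of t] by (simp add: ennreal_power)

lemma integral_lborel_affine:
  fixes f :: "'a::euclidean_space \<Rightarrow> real"
  assumes "c \<noteq> 0" and [measurable]: "f \<in> borel_measurable borel"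
  shows "(LINT y|lborel. f y) = \<bar>c\<bar> ^ DIM('a) * (LINT x|lborel. f (t + c *\<^sub>R x))"
proof -
  let ?N = "density (distr lborel borel (\<lambda>x. t + c *\<^sub>R x)) (\<lambda>_. ennreal (\<bar>c\<bar> ^ DIM('a)))"
  have "(LINT y|lborel. f y) = (LINT y|?N. f y)"
    using arg_cong[OF lborel_affine_density[OF assms(1)], of "\<lambda>M. integral\<^sup>L M f"] .
  also have "\<dots> = (LINT x|lborel. \<bar>c\<bar> ^ DIM('a) * f (t + c *\<^sub>R x))"
    by (simp add: integral_density integral_distr)
  finally show ?thesis by simp
qed

lemma integrable_lborel_affine:
  fixes f :: "'a::euclidean_space \<Rightarrow> real"
  assumes "c \<noteq> 0" and [measurable]: "f \<in> borel_measurable borel"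
  shows "integrable lborel f \<longleftrightarrow> integrable lborel (\<lambda>x. f (t + c *\<^sub>R x))"
proof -
  let ?N = "density (distr lborel borel (\<lambda>x. t + c *\<^sub>R x)) (\<lambda>_. ennreal (\<bar>c\<bar> ^ DIM('a)))"
  have "integrable lborel f \<longleftrightarrow> integrable ?N f"
    using arg_cong[OF lborel_affine_density[OF assms(1)], of "\<lambda>M. integrable M f"] .
  also have "\<dots> \<longleftrightarrow> integrable lborel (\<lambda>x. \<bar>c\<bar> ^ DIM('a) * f (t + c *\<^sub>R x))"
    by (simp add: integrable_density integrable_distr_eq)
  finally show ?thesis using assms(1) by simp
qed

definition truncated_fraclap :: "real \<Rightarrow> (real ^ 'n::finite \<Rightarrow> real) \<Rightarrow> real ^ 'n \<Rightarrow> real \<Rightarrow> real" where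
  "truncated_fraclap s u x \<epsilon> = (LINT y : - ball x \<epsilon> | lebesgue.
     (u x - u y) / norm (x - y) powr (real CARD('n) + 2 * s))"

text \<open>
  Averaging the integrand of the truncated integral over \<open>h\<close> and \<open>-h\<close> cancels the first-order term, and
  what remains is integrable up to the singularity.
\<close>
definition fraclap_quotient :: "real \<Rightarrow> (real ^ 'n::finite \<Rightarrow> real) \<Rightarrow> real ^ 'n \<Rightarrow> real ^ 'n \<Rightarrow> real" where
  "fraclap_quotient s u x h = (2 * u x - u (x + h) - u (x - h)) / (2 * norm h powr (real CARD('n) + 2 * s))"

abbreviation fractional_kernel :: "real \<Rightarrow> real ^ 'n::finite \<Rightarrow> real" where
  "fractional_kernel s h \<equiv> min 1 ((norm h)\<^sup>2) / norm h powr (real CARD('n) + 2 * s)"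

lemma integrable_fractional_kernel_vec:
  assumes "0 < s" "s < 1"
  shows "integrable lborel (fractional_kernel s :: real ^ 'n::finite \<Rightarrow> real)"
  using integrable_fractional_kernel[OF assms, where 'a = "real ^ 'n"] by simp

lemma integrable_truncated_kernel:
  fixes u :: "real ^ 'n::finite \<Rightarrow> real"
  assumes s: "0 < s" "s < 1" and u: "continuous_on UNIV u" "\<And>y. \<bar>u y\<bar> \<le> B" and "\<epsilon> > 0"
  shows "integrable lborel (\<lambda>y. indicator (- ball x \<epsilon>) y *
    ((u x - u y) / norm (x - y) powr (real CARD('n) + 2 * s)))"
    (is "integrable lborel ?f")
proof -
  let ?p = "real CARD('n) + 2 * s"
  have [measurable]: "u \<in> borel_measurable borel" using u(1) by (rule borel_measurable_continuous_onI)
  have B: "B \<ge> 0" using u(2)[of 0] by simp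
  have "integrable lborel (\<lambda>h. ?f (x + 1 *\<^sub>R h))"
  proof (rule Bochner_Integration.integrable_bound)
    show "integrable lborel (\<lambda>h :: real ^ 'n. 2 * B / min 1 (\<epsilon>\<^sup>2) * fractional_kernel s h)"
      using integrable_fractional_kernel_vec[OF s] by (intro integrable_mult_right)
    have "norm (?f (x + 1 *\<^sub>R h)) \<le> norm (2 * B / min 1 (\<epsilon>\<^sup>2) * fractional_kernel s h)" for h
    proof (cases "norm h < \<epsilon>")
      case False
      then have "\<epsilon>\<^sup>2 \<le> (norm h)\<^sup>2" using \<open>\<epsilon> > 0\<close> by (intro power_mono) auto
      moreover have "1 \<le> min 1 b / min 1 a" if "0 < a" "a \<le> b" for a b :: real
        using that by (auto simp: min_def)
      ultimately have *: "1 \<le> min 1 ((norm h)\<^sup>2) / min 1 (\<epsilon>\<^sup>2)" using \<open>\<epsilon> > 0\<close> by simp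
      have "\<bar>u x - u (x + h)\<bar> \<le> 2 * B * 1" using u(2)[of x] u(2)[of "x + h"] by linarith
      also have "\<dots> \<le> 2 * B * (min 1 ((norm h)\<^sup>2) / min 1 (\<epsilon>\<^sup>2))"
        using * B by (intro mult_left_mono) auto
      finally have "\<bar>u x - u (x + h)\<bar> / norm h powr ?p
          \<le> 2 * B * (min 1 ((norm h)\<^sup>2) / min 1 (\<epsilon>\<^sup>2)) / norm h powr ?p"
        by (rule divide_right_mono) simp
      moreover have "norm (2 * B / min 1 (\<epsilon>\<^sup>2) * fractional_kernel s h)
          = 2 * B * (min 1 ((norm h)\<^sup>2) / min 1 (\<epsilon>\<^sup>2)) / norm h powr ?p"
        using B by (simp add: abs_mult)
      ultimately show ?thesis using False B by (simp add: dist_norm abs_mult)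
    qed (simp add: dist_norm)
    then show "AE h in lborel. norm (?f (x + 1 *\<^sub>R h)) \<le> norm (2 * B / min 1 (\<epsilon>\<^sup>2) * fractional_kernel s h)"
      by simp
  qed measurable
  then show ?thesis by (subst integrable_lborel_affine[of 1 _ x]) auto
qed

lemma truncated_fraclap_eq_lborel:
  fixes u :: "real ^ 'n::finite \<Rightarrow> real"
  assumes u: "continuous_on UNIV u"
  shows "truncated_fraclap s u x \<epsilon> = (LINT y|lborel. indicator (- ball x \<epsilon>) y *
    ((u x - u y) / norm (x - y) powr (real CARD('n) + 2 * s)))"
proof -
  have [measurable]: "u \<in> borel_measurable borel" using u by (rule borel_measurable_continuous_onI)
  show ?thesis unfolding truncated_fraclap_def set_lebesgue_integral_def
    by (subst integral_completion) auto
qed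

text \<open>
  The average of the substitutions \<open>y = x + h\<close> and \<open>y = x - h\<close>, both of which preserve the region of
  integration.
\<close>
lemma truncated_fraclap_symmetric:
  fixes u :: "real ^ 'n::finite \<Rightarrow> real"
  assumes s: "0 < s" "s < 1" and u: "continuous_on UNIV u" "\<And>y. \<bar>u y\<bar> \<le> B" and \<epsilon>: "\<epsilon> > 0"
  shows "truncated_fraclap s u x \<epsilon> = (LINT h|lborel. indicator (- ball 0 \<epsilon>) h * fraclap_quotient s u x h)"
proof -
  let ?p = "real CARD('n) + 2 * s"
  define f where "f y = indicator (- ball x \<epsilon>) y * ((u x - u y) / norm (x - y) powr ?p)" for y
  have [measurable]: "u \<in> borel_measurable borel" using u(1) by (rule borel_measurable_continuous_onI)
  have [measurable]: "f \<in> borel_measurable borel" unfolding f_def[abs_def] by measurable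
  have int: "integrable lborel f"
    unfolding f_def[abs_def] by (rule integrable_truncated_kernel[OF s u \<epsilon>])
  have i1: "integrable lborel (\<lambda>h. f (x + 1 *\<^sub>R h))" and i2: "integrable lborel (\<lambda>h. f (x + (-1) *\<^sub>R h))"
    using int integrable_lborel_affine[of 1 f x] integrable_lborel_affine[of "-1" f x] by auto
  have "2 * truncated_fraclap s u x \<epsilon> = (LINT y|lborel. f y) + (LINT y|lborel. f y)"
    unfolding f_def truncated_fraclap_eq_lborel[OF u(1)] by simp
  also have "\<dots> = (LINT h|lborel. f (x + 1 *\<^sub>R h)) + (LINT h|lborel. f (x + (-1) *\<^sub>R h))"
    using integral_lborel_affine[of 1 f x] integral_lborel_affine[of "-1" f x] by simp
  also have "\<dots> = (LINT h|lborel. f (x + 1 *\<^sub>R h) + f (x + (-1) *\<^sub>R h))"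
    using i1 i2 by simp
  also have "\<dots> = (LINT h|lborel. 2 * (indicator (- ball 0 \<epsilon>) h * fraclap_quotient s u x h))"
  proof (rule Bochner_Integration.integral_cong[OF refl])
    fix h
    let ?a = "u x - u (x + h)" and ?b = "u x - u (x - h)" and ?d = "norm h powr ?p"
    have "f (x + 1 *\<^sub>R h) + f (x + (-1) *\<^sub>R h) = indicator (- ball 0 \<epsilon>) h * (?a / ?d + ?b / ?d)"
      by (simp add: f_def indicator_def dist_norm)
    also have "?a / ?d + ?b / ?d = 2 * ((?a + ?b) / (2 * ?d))"
      by (simp only: add_divide_distrib[symmetric] times_divide_eq_right mult_divide_mult_cancel_left_if) simp
    also have "?a + ?b = 2 * u x - u (x + h) - u (x - h)" by simp
    also have "\<dots> / (2 * ?d) = fraclap_quotient s u x h" by (simp only: fraclap_quotient_def)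
    finally show "f (x + 1 *\<^sub>R h) + f (x + (-1) *\<^sub>R h) = 2 * (indicator (- ball 0 \<epsilon>) h * fraclap_quotient s u x h)"
      by simp
  qed
  finally show ?thesis by simp
qed

text \<open>
  A quadratic bound on second differences dominates the symmetric quotient by a multiple of the kernel
  \<open>min 1 |h|\<^sup>2 / |h|\<^sup>p\<close>, and dominated convergence removes the truncation. The explicit factor in the bound
  serves to estimate the fractional Laplacian of the bump uniformly.
\<close>
lemma
  fixes u :: "real ^ 'n::finite \<Rightarrow> real"
  assumes s: "0 < s" "s < 1" and u: "continuous_on UNIV u" "\<And>y. \<bar>u y\<bar> \<le> B"
    and K: "\<And>h. norm h \<le> 1 \<Longrightarrow> \<bar>2 * u x - u (x + h) - u (x - h)\<bar> \<le> K * (norm h)\<^sup>2"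
  shows abs_fraclap_quotient_le: "\<bar>fraclap_quotient s u x h\<bar> \<le> (\<bar>K\<bar> + 4 * B) * fractional_kernel s h"
    and integrable_fraclap_quotient: "integrable lborel (fraclap_quotient s u x)"
    and truncated_fraclap_tendsto:
      "(truncated_fraclap s u x \<longlongrightarrow> (LINT h|lborel. fraclap_quotient s u x h)) (at_right 0)"
    and frac_laplacian_eq:
      "frac_laplacian s u x = frac_const CARD('n) s * (LINT h|lborel. fraclap_quotient s u x h)"
proof -
  let ?p = "real CARD('n) + 2 * s" and ?k = "fractional_kernel s :: real ^ 'n \<Rightarrow> real"
  let ?q = "fraclap_quotient s u x"
  define C where "C = \<bar>K\<bar> + 4 * B"
  have [measurable]: "u \<in> borel_measurable borel" using u(1) by (rule borel_measurable_continuous_onI)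
  have [measurable]: "?q \<in> borel_measurable borel" unfolding fraclap_quotient_def[abs_def] by measurable
  have B: "B \<ge> 0" using u(2)[of 0] by simp
  have C: "C \<ge> 0" using B by (simp add: C_def)
  have bound: "\<bar>?q h\<bar> \<le> C * ?k h" for h
  proof -
    have "\<bar>2 * u x - u (x + h) - u (x - h)\<bar> \<le> C * min 1 ((norm h)\<^sup>2)"
    proof (cases "norm h \<le> 1")
      case True
      have "K * (norm h)\<^sup>2 \<le> C * (norm h)\<^sup>2" using B by (intro mult_right_mono) (auto simp: C_def)
      then show ?thesis using K[OF True] True by (simp add: power_le_one min_absorb2)
    next
      case False
      then have "1 \<le> (norm h)\<^sup>2" by (simp add: one_le_power)
      moreover have "\<bar>2 * u x - u (x + h) - u (x - h)\<bar> \<le> 4 * B"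
        using u(2)[of x] u(2)[of "x + h"] u(2)[of "x - h"] by linarith
      ultimately show ?thesis by (simp add: C_def min_absorb1)
    qed
    also have "\<dots> \<le> 2 * (C * min 1 ((norm h)\<^sup>2))" using C by simp
    finally have "\<bar>2 * u x - u (x + h) - u (x - h)\<bar> / (2 * norm h powr ?p)
        \<le> 2 * (C * min 1 ((norm h)\<^sup>2)) / (2 * norm h powr ?p)"
      by (rule divide_right_mono) simp
    then show ?thesis by (simp add: fraclap_quotient_def)
  qed
  then show "\<bar>?q h\<bar> \<le> (\<bar>K\<bar> + 4 * B) * ?k h" unfolding C_def .
  have kint: "integrable lborel (\<lambda>h. C * ?k h)"
    using integrable_fractional_kernel_vec[OF s] by (intro integrable_mult_right)
  show "integrable lborel ?q"
  proof (rule Bochner_Integration.integrable_bound[OF kint])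
    show "AE h in lborel. norm (?q h) \<le> norm (C * ?k h)"
      unfolding real_norm_def by (intro AE_I2 order_trans[OF bound abs_ge_self])
  qed measurable
  have "((\<lambda>t. LINT h|lborel. indicator (- ball 0 (inverse t)) h * ?q h) \<longlongrightarrow> (LINT h|lborel. ?q h)) at_top"
  proof (rule integral_dominated_convergence_at_top[where w = "\<lambda>h. C * ?k h"])
    show "\<forall>\<^sub>F t in at_top. AE h in lborel. norm (indicator (- ball 0 (inverse t)) h * ?q h) \<le> C * ?k h"
    proof (rule always_eventually, intro allI AE_I2)
      fix t :: real and h
      have "0 \<le> C * ?k h" using C by (intro mult_nonneg_nonneg) auto
      then show "norm (indicator (- ball 0 (inverse t)) h * ?q h) \<le> C * ?k h"
        using bound[of h] by (simp add: indicator_def)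
    qed
    have "((\<lambda>t. indicator (- ball 0 (inverse t)) h * ?q h) \<longlongrightarrow> ?q h) at_top" for h
    proof (cases "h = 0")
      case True
      then show ?thesis by (simp add: fraclap_quotient_def)
    next
      case False
      have "\<forall>\<^sub>F t in at_top. indicator (- ball 0 (inverse t)) h * ?q h = ?q h"
        using eventually_ge_at_top[of "inverse (norm h)"]
      proof eventually_elim
        case (elim t)
        have "inverse t \<le> inverse (inverse (norm h))"
          using elim False by (intro le_imp_inverse_le) auto
        then show ?case by (simp add: indicator_def dist_norm)
      qed
      then show ?thesis by (rule tendsto_eventually)
    qed
    then show "AE h in lborel. ((\<lambda>t. indicator (- ball 0 (inverse t)) h * ?q h) \<longlongrightarrow> ?q h) at_top" by simp
  qed (use kint in measurable)
  moreover have "\<forall>\<^sub>F t in at_top. (LINT h|lborel. indicator (- ball 0 (inverse t)) h * ?q h)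
      = truncated_fraclap s u x (inverse t)"
    using eventually_gt_at_top[of 0]
    by eventually_elim (simp add: truncated_fraclap_symmetric[OF s u])
  ultimately have "((\<lambda>t. truncated_fraclap s u x (inverse t)) \<longlongrightarrow> (LINT h|lborel. ?q h)) at_top"
    by (rule Lim_transform_eventually)
  then show lim: "(truncated_fraclap s u x \<longlongrightarrow> (LINT h|lborel. ?q h)) (at_right 0)"
    by (simp add: filterlim_at_right_to_top)
  show "frac_laplacian s u x = frac_const CARD('n) s * (LINT h|lborel. ?q h)"
    using tendsto_Lim[OF _ lim] by (simp add: frac_laplacian_def truncated_fraclap_def[abs_def])
qed

lemma frac_const_pos:
  assumes "0 < s" "s < 1" shows "frac_const n s > 0"
proof -
  have "Gamma (- s) \<noteq> 0"
  proof -
    have "- s \<notin> \<int>\<^sub>\<le>\<^sub>0"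
    proof
      assume "- s \<in> \<int>\<^sub>\<le>\<^sub>0"
      then obtain k :: nat where "- s = - real k" by (auto elim!: nonpos_Ints_cases')
      then have "0 < real k" "real k < 1" using assms by auto
      then show False by simp
    qed
    then show ?thesis by (simp add: Gamma_eq_zero_iff)
  qed
  moreover have "Gamma (s + real n / 2) > 0" using assms by (intro Gamma_real_pos) (simp add: add_pos_nonneg)
  ultimately show ?thesis by (simp add: frac_const_def)
qed

lemma bounded_second_partials:
  fixes u :: "real ^ 'n::finite \<Rightarrow> real"
  assumes u: "smooth_fun u" and S: "compact S"
  obtains K where "\<And>z i j. z \<in> S \<Longrightarrow> \<bar>partial_derivative j (partial_derivative i u) z\<bar> \<le> K"
proof -
  let ?D = "\<lambda>i j. partial_derivative j (partial_derivative i u)"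
  have "\<exists>K. \<forall>z\<in>S. \<bar>?D i j z\<bar> \<le> K" for i j
  proof -
    have "smooth_fun (?D i j)" by (intro smooth_fun_differentiable(2) u)
    then have "compact (?D i j ` S)" by (intro compact_continuous_image smooth_fun_continuous S)
    then have "bounded (?D i j ` S)" by (rule compact_imp_bounded)
    then show ?thesis by (auto simp: bounded_iff)
  qed
  then have "\<exists>K. \<forall>i j. \<forall>z\<in>S. \<bar>?D i j z\<bar> \<le> K i j"
    by (intro choice allI) blast
  then obtain K where K: "\<And>i j z. z \<in> S \<Longrightarrow> \<bar>?D i j z\<bar> \<le> K i j" by blast
  show ?thesis
  proof (rule that)
    fix z i j assume z: "z \<in> S"
    have "\<bar>?D i j z\<bar> \<le> \<bar>K i j\<bar>" using K[where i = i and j = j, OF z] by linarith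
    also have "\<dots> \<le> (\<Sum>j\<in>UNIV. \<bar>K i j\<bar>)" by (rule member_le_sum) auto
    also have "\<dots> \<le> (\<Sum>i\<in>UNIV. \<Sum>j\<in>UNIV. \<bar>K i j\<bar>)"
      by (rule member_le_sum[where f = "\<lambda>i. \<Sum>j\<in>UNIV. \<bar>K i j\<bar>"]) (auto intro: sum_nonneg)
    finally show "\<bar>?D i j z\<bar> \<le> (\<Sum>i\<in>UNIV. \<Sum>j\<in>UNIV. \<bar>K i j\<bar>)" .
  qed
qed

lemma
  fixes u :: "real ^ 'n::finite \<Rightarrow> real"
  assumes s: "0 < s" "s < 1" and u: "smooth_fun u" "\<And>y. \<bar>u y\<bar> \<le> B"
  shows integrable_fraclap_quotient_smooth: "integrable lborel (fraclap_quotient s u x)"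
    and truncated_fraclap_tendsto_smooth:
      "(truncated_fraclap s u x \<longlongrightarrow> (LINT h|lborel. fraclap_quotient s u x h)) (at_right 0)"
    and frac_laplacian_smooth:
      "frac_laplacian s u x = frac_const CARD('n) s * (LINT h|lborel. fraclap_quotient s u x h)"
proof -
  obtain K where "\<And>z i j. z \<in> cball x 1 \<Longrightarrow> \<bar>partial_derivative j (partial_derivative i u) z\<bar> \<le> K"
    using bounded_second_partials[OF u(1), of "cball x 1"] by auto
  from second_difference_le[OF u(1) this]
  have K: "\<And>h. norm h \<le> 1 \<Longrightarrow>
      \<bar>2 * u x - u (x + h) - u (x - h)\<bar> \<le> 2 * (real CARD('n))\<^sup>2 * K * (norm h)\<^sup>2" .
  note cont = smooth_fun_continuous[OF u(1), of UNIV]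
  show "integrable lborel (fraclap_quotient s u x)"
    by (rule integrable_fraclap_quotient[OF s cont u(2) K])
  show "(truncated_fraclap s u x \<longlongrightarrow> (LINT h|lborel. fraclap_quotient s u x h)) (at_right 0)"
    by (rule truncated_fraclap_tendsto[OF s cont u(2) K])
  show "frac_laplacian s u x = frac_const CARD('n) s * (LINT h|lborel. fraclap_quotient s u x h)"
    by (rule frac_laplacian_eq[OF s cont u(2) K])
qed

lemma frac_laplacian_cmult:
  fixes u :: "real ^ 'n::finite \<Rightarrow> real"
  assumes s: "0 < s" "s < 1" and u: "smooth_fun u" "\<And>y. \<bar>u y\<bar> \<le> B"
  shows "frac_laplacian s (\<lambda>x. c * u x) x = c * frac_laplacian s u x"
proof -
  have "smooth_fun (\<lambda>x. c * u x)" using u(1) by (auto simp: smooth_fun_def intro!: Ck_mult Ck_const)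
  moreover have "\<bar>c * u y\<bar> \<le> \<bar>c\<bar> * B" for y unfolding abs_mult by (intro mult_left_mono u) simp
  ultimately have "frac_laplacian s (\<lambda>x. c * u x) x
      = frac_const CARD('n) s * (LINT h|lborel. fraclap_quotient s (\<lambda>x. c * u x) x h)"
    by (rule frac_laplacian_smooth[OF s])
  also have "fraclap_quotient s (\<lambda>x. c * u x) x = (\<lambda>h. c * fraclap_quotient s u x h)"
    by (rule ext) (simp add: fraclap_quotient_def algebra_simps)
  finally show ?thesis by (simp add: frac_laplacian_smooth[OF s u])
qed

section \<open>Lower bound for the fractional Laplacian of the profile\<close>

lemma convex_on_powr_neg:
  fixes b :: real assumes "b \<ge> 0" shows "convex_on {0<..} (\<lambda>x. x powr (- b))"
proof (rule f''_ge0_imp_convex)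
  fix x :: real assume "x \<in> {0<..}"
  then show "((\<lambda>x. x powr (- b)) has_real_derivative (- b) * x powr (- b - 1)) (at x)"
    "((\<lambda>x. (- b) * x powr (- b - 1)) has_real_derivative b * (b + 1) * x powr (- b - 1 - 1)) (at x)"
    "0 \<le> b * (b + 1) * x powr (- b - 1 - 1)"
    using assms by (auto intro!: derivative_eq_intros simp: algebra_simps)
qed simp

text \<open>
  Karamata's inequality for two points: with a fixed sum, a convex function has the larger total on the
  pair that is spread further apart.
\<close>
lemma convex_on_majorize:
  fixes f :: "real \<Rightarrow> real"
  assumes f: "convex_on S f" and S: "c \<in> S" "d \<in> S" and le: "c \<le> a" "a \<le> d" and eq: "a + b = c + d"
  shows "f a + f b \<le> f c + f d"
proof (cases "c = d")
  case True
  then show ?thesis using le eq by auto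
next
  case False
  then have cd: "c < d" using le by simp
  define t where "t = (a - c) / (d - c)"
  have t: "0 \<le> t" "t \<le> 1" using cd le by (auto simp: t_def)
  have "t * (d - c) = a - c" using cd by (simp add: t_def)
  then have a: "a = (1 - t) *\<^sub>R c + t *\<^sub>R d" and b: "b = (1 - (1 - t)) *\<^sub>R c + (1 - t) *\<^sub>R d"
    using eq by (simp_all add: algebra_simps)
  have "f a \<le> (1 - t) * f c + t * f d" unfolding a using convex_onD[OF f t S] .
  moreover have "f b \<le> (1 - (1 - t)) * f c + (1 - t) * f d" unfolding b
    using t by (intro convex_onD[OF f _ _ S]) auto
  ultimately show ?thesis by (simp add: algebra_simps)
qed

text \<open>
  For a pure power \<open>W(r) = r\<close> to the power \<open>-\<beta>\<close> this would be an equality. With \<open>A > 0\<close>, multiplication by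
  powers of \<open>t\<close> turns the claim into the inequality
  \<open>f(A + t\<^sup>2 \<rho>\<^sup>2) + f(t\<^sup>2 A + \<rho>\<^sup>2) \<le> f(t\<^sup>2 (A + \<rho>\<^sup>2)) + f(A + \<rho>\<^sup>2)\<close> for the convex function
  \<open>f\<close> given by the power \<open>-\<beta>/2\<close>. On both sides the arguments have the same sum, and those on the right
  are spread further apart.
\<close>
lemma profile_kelvin_ineq:
  fixes A \<beta> t \<rho> :: real
  defines "W \<equiv> \<lambda>r. (A + r\<^sup>2) powr (- \<beta> / 2)"
  assumes A: "A > 0" and \<beta>: "\<beta> > 0" and t: "0 < t" "t \<le> 1"
  shows "t powr \<gamma> * (W (t * \<rho>) - W \<rho>) \<le> t powr (\<gamma> - \<beta>) * (W \<rho> - W (\<rho> / t))"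
proof -
  have pos: "A + r\<^sup>2 > 0" for r using A by (simp add: add_pos_nonneg)
  have scale: "t powr (- \<beta>) * W r = (t\<^sup>2 * (A + r\<^sup>2)) powr (- (\<beta> / 2))" for r
  proof -
    have "t\<^sup>2 powr (- (\<beta> / 2)) = t powr (- \<beta>)"
      using t powr_powr[of t 2 "- (\<beta> / 2)"] by simp
    then show ?thesis using t pos[of r] by (simp add: W_def powr_mult)
  qed
  have t2: "t\<^sup>2 \<le> 1" using t by (simp add: power_le_one)
  have "(A + (t * \<rho>)\<^sup>2) powr (- (\<beta> / 2)) + (t\<^sup>2 * A + \<rho>\<^sup>2) powr (- (\<beta> / 2))
      \<le> (t\<^sup>2 * (A + \<rho>\<^sup>2)) powr (- (\<beta> / 2)) + (A + \<rho>\<^sup>2) powr (- (\<beta> / 2))"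
  proof (rule convex_on_majorize[OF convex_on_powr_neg])
    show "t\<^sup>2 * (A + \<rho>\<^sup>2) \<le> A + (t * \<rho>)\<^sup>2" "A + (t * \<rho>)\<^sup>2 \<le> A + \<rho>\<^sup>2"
      using t2 A mult_right_mono[OF t2, of A] mult_right_mono[OF t2, of "\<rho>\<^sup>2"]
      by (simp_all add: algebra_simps power_mult_distrib)
  qed (use A \<beta> t pos in \<open>auto simp: algebra_simps power_mult_distrib intro!: add_pos_nonneg\<close>)
  also have "t\<^sup>2 * A + \<rho>\<^sup>2 = t\<^sup>2 * (A + (\<rho> / t)\<^sup>2)"
    using t by (simp add: power_divide algebra_simps)
  finally have "W (t * \<rho>) + t powr (- \<beta>) * W (\<rho> / t) \<le> t powr (- \<beta>) * W \<rho> + W \<rho>"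
    unfolding scale by (simp add: W_def)
  then have "W (t * \<rho>) - W \<rho> \<le> t powr (- \<beta>) * (W \<rho> - W (\<rho> / t))" by (simp add: algebra_simps)
  then have "t powr \<gamma> * (W (t * \<rho>) - W \<rho>) \<le> t powr \<gamma> * (t powr (- \<beta>) * (W \<rho> - W (\<rho> / t)))"
    by (rule mult_left_mono) simp
  also have "\<dots> = t powr (\<gamma> - \<beta>) * (W \<rho> - W (\<rho> / t))"
    by (simp add: powr_add[symmetric] mult.assoc[symmetric])
  finally show ?thesis .
qed

text \<open>
  The reason for inverting in the sphere through \<open>x\<close>: a kernel that is a power of the distance to \<open>x\<close> is
  reproduced up to a factor depending on \<open>|z|\<close> alone.
\<close>
lemma norm_inversion_diff:
  fixes x z :: "'a::real_inner"
  assumes "z \<noteq> 0"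
  shows "norm (x - (norm x / norm z)\<^sup>2 *\<^sub>R z) = norm x / norm z * norm (x - z)"
proof -
  let ?t = "norm x / norm z"
  have t: "?t * norm z = norm x" using assms by simp
  have "(norm (x - ?t\<^sup>2 *\<^sub>R z))\<^sup>2 = (norm x)\<^sup>2 - 2 * ?t\<^sup>2 * (x \<bullet> z) + ?t\<^sup>2 * (?t * norm z)\<^sup>2"
    by (simp only: power2_norm_eq_inner power_mult_distrib)
       (simp add: inner_diff inner_commute algebra_simps power2_eq_square)
  also have "\<dots> = ?t\<^sup>2 * (norm x)\<^sup>2 - 2 * ?t\<^sup>2 * (x \<bullet> z) + (?t * norm z)\<^sup>2"
    unfolding t by simp
  also have "\<dots> = (?t * norm (x - z))\<^sup>2"
    by (simp only: power2_norm_eq_inner power_mult_distrib)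
       (simp add: inner_diff inner_commute algebra_simps)
  finally show ?thesis by (rule power2_eq_imp_eq) simp_all
qed

text \<open>
  Let \<open>f\<close> be the truncated integrand, \<open>\<rho> = |x|\<close>, \<open>\<gamma> = n - 2 s\<close> and \<open>t = \<rho> / |z|\<close>. The negative part of \<open>f\<close> lives in
  the ball of radius \<open>\<rho>\<close>. Inversion multiplies the kernel and the volume element together by \<open>t\<close> to the power
  \<open>2 n - p = \<gamma>\<close>, and \<open>profile_kelvin_ineq\<close> then shows that the transported negative part at \<open>z\<close> is at
  most \<open>t\<close> to the power \<open>\<gamma> - \<beta>\<close> times \<open>f(z)\<close>; as \<open>t < 1\<close> and \<open>\<beta> < \<gamma>\<close>, this is less than \<open>f(z)\<close>. An
  exterior point is at least as far from \<open>x\<close> as its image, so the transported region avoids the ball of radius \<open>\<epsilon>\<close>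
  around \<open>x\<close>, and the truncation does no harm. The surplus is bounded
  below on a ball of radius \<open>M / 2\<close> contained in the shell \<open>2 M \<le> |z| \<le> 3 M\<close>, where \<open>t \<le> 1/2\<close> and all
  quantities are comparable to powers of \<open>M\<close>.
\<close>
lemma truncated_fraclap_profile_lower:
  fixes x :: "real ^ 'n::finite"
  defines "n \<equiv> real CARD('n)"
  assumes s: "0 < s" "s < 1" and A: "A \<ge> 1" and \<beta>: "0 < \<beta>" "\<beta> < n - 2 * s" and \<epsilon>: "0 < \<epsilon>" "\<epsilon> \<le> 1"
    and u: "smooth_fun u" "\<And>y. u y = (A + (norm y)\<^sup>2) powr (- \<beta> / 2)"
  defines "c \<equiv> (1 - 2 powr (- (n - 2 * s - \<beta>))) * (1 - 2 powr (- \<beta>)) * 4 powr (- (n + 2 * s))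
      * (unit_ball_vol n / 2 ^ CARD('n))"
  shows "c * sqrt (A + (norm x)\<^sup>2) powr (- \<beta> - 2 * s) \<le> truncated_fraclap s u x \<epsilon>"
proof -
  define p where "p = n + 2 * s"
  define \<delta> where "\<delta> = n - 2 * s - \<beta>"
  define \<rho> where "\<rho> = norm x"
  define W where "W r = (A + r\<^sup>2) powr (- \<beta> / 2)" for r
  define M where "M = sqrt (A + \<rho>\<^sup>2)"
  have \<delta>: "\<delta> > 0" using \<beta> by (simp add: \<delta>_def)
  have pos: "A + r\<^sup>2 > 0" for r using A by (simp add: add_pos_nonneg)
  have M1: "M \<ge> 1" using A by (simp add: M_def add_increasing2)
  have \<rho>M: "\<rho> \<le> M" unfolding M_def using A by (intro real_le_rsqrt) simp
  have \<rho>0: "\<rho> \<ge> 0" by (simp add: \<rho>_def)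
  have uW: "u y = W (norm y)" for y by (simp add: u W_def)
  have W_mono: "W b \<le> W a" if "0 \<le> a" "a \<le> b" for a b
  proof -
    have "a\<^sup>2 \<le> b\<^sup>2" using that by (intro power_mono)
    then show ?thesis unfolding W_def using pos[of a] \<beta> by (intro powr_mono2') auto
  qed
  have W\<rho>: "W \<rho> = M powr (- \<beta>)"
    unfolding W_def M_def using pos[of \<rho>] by (simp add: powr_half_sqrt[symmetric] powr_powr)
  have u_le: "\<bar>u y\<bar> \<le> 1" for y
  proof -
    have "u y \<le> 1 powr (- \<beta> / 2)"
      unfolding u using A \<beta> by (intro powr_mono2') (auto intro: add_increasing2)
    then show ?thesis by (simp add: u)
  qed
  note cont = smooth_fun_continuous[OF u(1), of UNIV]
  have [measurable]: "u \<in> borel_measurable borel" using cont by (rule borel_measurable_continuous_onI)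
  have [measurable]: "W \<in> borel_measurable borel" unfolding W_def[abs_def] by measurable
  define f where "f y = indicator (- ball x \<epsilon>) y * ((u x - u y) / norm (x - y) powr p)" for y
  have [measurable]: "f \<in> borel_measurable borel" unfolding f_def[abs_def] by measurable
  have f_int: "integrable lborel f"
    unfolding f_def[abs_def] p_def n_def by (rule integrable_truncated_kernel[OF s cont u_le \<epsilon>(1)])
  have f_eq: "f y = (if \<epsilon> \<le> norm (x - y) then (W \<rho> - W (norm y)) / norm (x - y) powr p else 0)" for y
    by (simp add: f_def uW \<rho>_def dist_norm)

  (* g majorizes the transported negative part; delta = gamma - beta. *)
  define g where "g z = (if \<rho> < norm z then ennreal ((\<rho> / norm z) powr \<delta> * f z) else 0)" for z :: "real ^ 'n"
  have [measurable]: "g \<in> borel_measurable borel" unfolding g_def[abs_def] by measurable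
  have inner: "(\<integral>\<^sup>+y. ennreal (- f y) \<partial>lborel) \<le> (\<integral>\<^sup>+z. g z \<partial>lborel)"
  proof (cases "\<rho> = 0")
    case True
    have "- f y \<le> 0" for y
      using W_mono[of \<rho> "norm y"] True by (simp add: f_eq)
    then show ?thesis by (simp add: ennreal_neg)
  next
    case False
    then have \<rho>: "\<rho> > 0" using \<rho>0 by simp
    have "(\<integral>\<^sup>+y. ennreal (- f y) \<partial>lborel) =
        (\<integral>\<^sup>+z. ennreal ((\<rho> / norm z) ^ (2 * CARD('n))) * ennreal (- f ((\<rho> / norm z)\<^sup>2 *\<^sub>R z)) \<partial>lborel)"
      by (subst nn_integral_inversion[OF \<rho>]) simp_all
    also have "\<dots> \<le> (\<integral>\<^sup>+z. g z \<partial>lborel)"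
    proof (rule nn_integral_mono)
      fix z :: "real ^ 'n"
      define t where "t = \<rho> / norm z"
      show "ennreal ((\<rho> / norm z) ^ (2 * CARD('n))) * ennreal (- f ((\<rho> / norm z)\<^sup>2 *\<^sub>R z)) \<le> g z"
      proof (cases "\<rho> < norm z")
        case True
        then have nz: "norm z > 0" using \<rho> by linarith
        then have z: "z \<noteq> 0" and t: "0 < t" "t < 1" using \<rho> True by (simp_all add: t_def)
        then have zt: "norm z = \<rho> / t" using \<rho> by (simp add: t_def)
        have nJ: "norm (t\<^sup>2 *\<^sub>R z) = t * \<rho>"
          using t z by (simp add: t_def power2_eq_square)
        have dJ: "norm (x - t\<^sup>2 *\<^sub>R z) = t * norm (x - z)"
          using norm_inversion_diff[OF z, of x] by (simp add: t_def \<rho>_def)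
        have "t ^ (2 * CARD('n)) * (- f (t\<^sup>2 *\<^sub>R z)) \<le> t powr \<delta> * f z"
        proof (cases "\<epsilon> \<le> t * norm (x - z)")
          case True
          have "t * norm (x - z) \<le> norm (x - z)" using t by (simp add: mult_left_le_one_le)
          then have far: "\<epsilon> \<le> norm (x - z)" using True by linarith
          have "t ^ (2 * CARD('n)) / t powr p = t powr (\<delta> + \<beta>)"
            using t by (simp add: powr_realpow[symmetric] powr_diff[symmetric] p_def n_def \<delta>_def)
          moreover have "- f (t\<^sup>2 *\<^sub>R z) = (W (t * \<rho>) - W \<rho>) / (t powr p * norm (x - z) powr p)"
            using True t unfolding f_eq dJ nJ by (simp add: powr_mult minus_divide_left)
          ultimately have "t ^ (2 * CARD('n)) * (- f (t\<^sup>2 *\<^sub>R z))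
              = t powr (\<delta> + \<beta>) * (W (t * \<rho>) - W \<rho>) / norm (x - z) powr p"
            by (metis (no_types, lifting) divide_divide_eq_left times_divide_eq_left times_divide_eq_right)
          also have "\<dots> \<le> t powr (\<delta> + \<beta> - \<beta>) * (W \<rho> - W (\<rho> / t)) / norm (x - z) powr p"
            unfolding W_def using A \<beta> t
            by (intro divide_right_mono profile_kelvin_ineq) auto
          also have "\<dots> = t powr \<delta> * f z" using far by (simp add: f_eq zt)
          finally show ?thesis .
        next
          case False
          have "0 \<le> f z" using W_mono[of \<rho> "norm z"] True \<rho>0 by (simp add: f_eq)
          then show ?thesis using False by (simp add: f_eq[of "t\<^sup>2 *\<^sub>R z"] dJ)
        qed
        moreover have "ennreal (t ^ (2 * CARD('n))) * ennreal (- f (t\<^sup>2 *\<^sub>R z))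
            = ennreal (t ^ (2 * CARD('n)) * (- f (t\<^sup>2 *\<^sub>R z)))"
          using t by (intro ennreal_mult'[symmetric]) simp
        ultimately show ?thesis using True by (simp add: g_def t_def[symmetric] ennreal_leI)
      next
        case False
        have "\<rho> \<le> norm (t\<^sup>2 *\<^sub>R z)" if "z \<noteq> 0"
        proof -
          have "\<rho> * norm z \<le> \<rho> * \<rho>" using False \<rho>0 by (intro mult_left_mono) auto
          then show ?thesis using that by (simp add: t_def power2_eq_square field_simps)
        qed
        then have "- f (t\<^sup>2 *\<^sub>R z) \<le> 0" if "z \<noteq> 0"
          using that W_mono[OF \<rho>0, of "norm (t\<^sup>2 *\<^sub>R z)"] by (simp add: f_eq del: norm_scaleR)
        then show ?thesis
          by (cases "z = 0") (simp_all add: zero_power t_def[symmetric] ennreal_neg)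
      qed
    qed
    finally show ?thesis .
  qed

  (* Any unit vector serves as the direction in which the ball S is placed. *)
  define e :: "real ^ 'n" where "e = axis undefined 1"
  define S where "S = cball ((5 / 2 * M) *\<^sub>R e) (M / 2)"
  define \<kappa> where "\<kappa> = (1 - 2 powr (- \<delta>)) * (1 - 2 powr (- \<beta>)) * M powr (- \<beta>) * (4 * M) powr (- p)"
  have e: "norm e = 1" by (simp add: e_def)
  have d: "2 powr (- \<delta>) \<le> 1" "2 powr (- \<beta>) \<le> 1"
    using \<delta> \<beta> powr_mono[of "- \<delta>" 0 2] powr_mono[of "- \<beta>" 0 2] by simp_all
  then have \<kappa>: "\<kappa> \<ge> 0" unfolding \<kappa>_def by simp
  have S: "2 * M \<le> norm z \<and> norm z \<le> 3 * M" if "z \<in> S" for z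
  proof -
    have "norm ((5 / 2 * M) *\<^sub>R e) = 5 / 2 * M" using e M1 by simp
    moreover have "norm ((5 / 2 * M) *\<^sub>R e - z) \<le> M / 2" using that by (simp add: S_def dist_norm)
    ultimately show ?thesis
      using norm_triangle_ineq2[of "(5 / 2 * M) *\<^sub>R e" z] norm_triangle_ineq2[of z "(5 / 2 * M) *\<^sub>R e"]
      by (simp add: norm_minus_commute)
  qed
  have [measurable]: "S \<in> sets borel" by (simp add: S_def)
  have outer: "g z + ennreal \<kappa> * indicator S z \<le> ennreal (f z)" for z
  proof (cases "\<rho> < norm z")
    case True
    define t where "t = \<rho> / norm z"
    have nz: "norm z > 0" using True \<rho>0 by linarith
    then have t: "0 \<le> t" "t \<le> 1" using True \<rho>0 by (simp_all add: t_def)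
    have f0: "0 \<le> f z" using W_mono[of \<rho> "norm z"] True \<rho>0 by (simp add: f_eq)
    have t\<delta>: "t powr \<delta> \<le> 1" using t \<delta> powr_mono2[of \<delta> t 1] by simp
    show ?thesis
    proof (cases "z \<in> S")
      case True
      note zS = S[OF True]
      have "t \<le> 1 / 2"
        unfolding t_def using zS \<rho>M nz by (simp add: divide_le_eq)
      then have "t powr \<delta> \<le> (1 / 2) powr \<delta>" using t \<delta> by (intro powr_mono2) auto
      then have t\<delta>2: "t powr \<delta> \<le> 2 powr (- \<delta>)" by (simp add: powr_minus_divide powr_divide)
      have "norm z - norm x \<le> norm (x - z)" using norm_triangle_ineq2[of z x] by (simp add: norm_minus_commute)
      then have far: "\<epsilon> \<le> norm (x - z)" "0 < norm (x - z)"
        using zS \<rho>M M1 \<epsilon> unfolding \<rho>_def by linarith+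
      have near: "norm (x - z) \<le> 4 * M"
        using norm_triangle_ineq4[of x z] zS \<rho>M unfolding \<rho>_def by linarith
      have "W (norm z) \<le> ((2 * M)\<^sup>2) powr (- \<beta> / 2)"
        unfolding W_def using M1 zS \<beta> A by (intro powr_mono2' add_increasing power_mono) auto
      also have "\<dots> = (2 * M) powr (- \<beta>)"
        using M1 powr_powr[of "2 * M" 2 "- \<beta> / 2"] by simp
      also have "\<dots> = 2 powr (- \<beta>) * M powr (- \<beta>)" using M1 by (simp add: powr_mult)
      finally have "(1 - 2 powr (- \<beta>)) * M powr (- \<beta>) \<le> W \<rho> - W (norm z)"
        unfolding W\<rho> by (simp add: algebra_simps)
      moreover have "(4 * M) powr (- p) \<le> norm (x - z) powr (- p)"
        using far near s by (intro powr_mono2') (auto simp: p_def n_def)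
      ultimately have "(1 - 2 powr (- \<beta>)) * M powr (- \<beta>) * (4 * M) powr (- p)
          \<le> (W \<rho> - W (norm z)) * norm (x - z) powr (- p)"
        using \<beta> W_mono[of \<rho> "norm z"] \<open>\<rho> < norm z\<close> \<rho>0 by (intro mult_mono) auto
      also have "\<dots> = f z" using far by (simp add: f_eq powr_minus divide_inverse)
      finally have "(1 - 2 powr (- \<delta>)) * ((1 - 2 powr (- \<beta>)) * M powr (- \<beta>) * (4 * M) powr (- p))
          \<le> (1 - t powr \<delta>) * f z"
        using t\<delta> t\<delta>2 d f0 by (intro mult_mono) simp_all
      then have "t powr \<delta> * f z + \<kappa> \<le> f z" by (simp add: \<kappa>_def algebra_simps)
      then have "ennreal (t powr \<delta> * f z + \<kappa>) \<le> ennreal (f z)" by (rule ennreal_leI)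
      then show ?thesis using \<open>\<rho> < norm z\<close> True \<kappa> f0
        by (simp add: g_def t_def[symmetric] ennreal_plus)
    next
      case False
      have "t powr \<delta> * f z \<le> 1 * f z" using t\<delta> f0 by (intro mult_right_mono)
      then show ?thesis using \<open>\<rho> < norm z\<close> False by (simp add: g_def t_def[symmetric] ennreal_leI)
    qed
  next
    case False
    then have "z \<notin> S" using S[of z] \<rho>M M1 by auto
    then show ?thesis using False by (simp add: g_def)
  qed
  have vol: "emeasure lborel S = ennreal (unit_ball_vol n * (M / 2) ^ CARD('n))"
    unfolding S_def n_def using M1 by (subst emeasure_cball) auto
  let ?v = "unit_ball_vol n * (M / 2) ^ CARD('n)"
  have v0: "?v \<ge> 0" using M1 by (simp add: n_def)
  let ?P = "\<integral>\<^sup>+y. ennreal (f y) \<partial>lborel" and ?N = "\<integral>\<^sup>+y. ennreal (- f y) \<partial>lborel"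
  have "?N + ennreal (\<kappa> * ?v) \<le> (\<integral>\<^sup>+z. g z \<partial>lborel) + (\<integral>\<^sup>+z. ennreal \<kappa> * indicator S z \<partial>lborel)"
    using inner \<kappa> v0 by (simp add: nn_integral_cmult vol ennreal_mult add_mono)
  also have "\<dots> = (\<integral>\<^sup>+z. g z + ennreal \<kappa> * indicator S z \<partial>lborel)"
    by (subst nn_integral_add) auto
  also have "\<dots> \<le> ?P" by (intro nn_integral_mono outer)
  finally have le: "?N + ennreal (\<kappa> * ?v) \<le> ?P" .
  have fin: "?P < \<infinity>" "?N < \<infinity>" using f_int unfolding real_integrable_def by (auto simp: top.not_eq_extremum)
  have "enn2real (?N + ennreal (\<kappa> * ?v)) \<le> enn2real ?P" using le fin by (intro enn2real_mono) auto
  then have "\<kappa> * ?v \<le> enn2real ?P - enn2real ?N"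
    using fin \<kappa> v0 by (simp add: enn2real_plus)
  also have "\<dots> = (LINT y|lborel. f y)" using f_int by (simp add: real_lebesgue_integral_def)
  also have "\<dots> = truncated_fraclap s u x \<epsilon>"
    unfolding f_def p_def n_def truncated_fraclap_eq_lborel[OF cont] ..
  finally have "\<kappa> * ?v \<le> truncated_fraclap s u x \<epsilon>" .
  moreover have "\<kappa> * ?v = c * M powr (- \<beta> - 2 * s)"
  proof -
    have "(M / 2) ^ CARD('n) = M powr n / 2 ^ CARD('n)" using M1 by (simp add: power_divide powr_realpow n_def)
    moreover have "M powr (- \<beta>) * (M powr (- p) * M powr n) = M powr (- \<beta> - 2 * s)"
      by (simp add: powr_add[symmetric] p_def)
    moreover have "(4 * M) powr (- p) = 4 powr (- p) * M powr (- p)" using M1 by (simp add: powr_mult)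
    ultimately show ?thesis unfolding \<kappa>_def c_def \<delta>_def p_def by (simp add: mult_ac)
  qed
  ultimately show ?thesis by (simp add: M_def \<rho>_def)
qed

section \<open>Existence above the critical exponent\<close>

lemma smooth_fun_profile:
  fixes A a :: real
  assumes "A > 0"
  shows "smooth_fun (\<lambda>x :: real ^ 'n::finite. (A + (norm x)\<^sup>2) powr a)"
proof -
  have "smooth_fun (\<lambda>x :: real ^ 'n. (\<lambda>t. t powr a) (A + 1 * (x \<bullet> x)))"
  proof (rule smooth_fun_compose[where F = "{\<lambda>t. c * t powr a | c a. True}" and S = "{0<..}"
        and g = "\<lambda>t. t powr a" and v = "\<lambda>x. A + 1 * (x \<bullet> x)"])
    fix g :: "real \<Rightarrow> real" assume "g \<in> {\<lambda>t. c * t powr a | c a. True}"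
    then obtain c a where g: "g = (\<lambda>t. c * t powr a)" by blast
    show "\<exists>g'\<in>{\<lambda>t. c * t powr a | c a. True}. \<forall>t\<in>{0<..}. (g has_real_derivative g' t) (at t)"
    proof (rule bexI[where x = "\<lambda>t. (c * a) * t powr (a - 1)"])
      show "\<forall>t\<in>{0<..}. (g has_real_derivative (c * a) * t powr (a - 1)) (at t)"
        unfolding g by (auto intro!: derivative_eq_intros)
    qed blast
  next
    show "(\<lambda>t. t powr a) \<in> {\<lambda>t. c * t powr a | c a. True}"
      by (rule CollectI, rule exI[where x = 1], rule exI[where x = a]) simp
    show "A + 1 * (x \<bullet> x) \<in> {0<..}" for x :: "real ^ 'n" using assms by (simp add: add_pos_nonneg)
  qed (rule smooth_fun_quadratic)
  then show ?thesis by (simp add: power2_norm_eq_inner)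
qed

lemma laplacian_quadratic: "laplacian (\<lambda>x :: real ^ 'n::finite. a + b * (x \<bullet> x)) x = 2 * b * real CARD('n)"
proof -
  have "partial_derivative i (\<lambda>x :: real ^ 'n. a + b * (x \<bullet> x)) = (\<lambda>x. (2 * b) * x $ i)" for i
    by (rule ext) (simp add: partial_derivative_quadratic)
  then show ?thesis by (simp add: laplacian_def partial_derivative_coordinate)
qed

text \<open>
  With \<open>v = A + |x|\<^sup>2\<close> the Laplacian is \<open>\<kappa> \<beta> v\<close> to the power \<open>-\<beta>/2 - 1\<close> times
  \<open>(\<beta> + 2) |x|\<^sup>2 / v - n\<close>, and the last factor is at most \<open>\<beta> + 2 - n \<le> 2\<close>.
\<close>
lemma laplacian_profile_le:
  fixes x :: "real ^ 'n::finite"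
  assumes A: "A > 0" and \<kappa>: "\<kappa> \<ge> 0" and \<beta>: "0 < \<beta>" "\<beta> \<le> real CARD('n)"
  shows "laplacian (\<lambda>x :: real ^ 'n. \<kappa> * (A + (norm x)\<^sup>2) powr (- \<beta> / 2)) x
    \<le> 2 * \<kappa> * \<beta> * (A + (norm x)\<^sup>2) powr (- \<beta> / 2 - 1)"
proof -
  define a where "a = - \<beta> / 2"
  define v where "v = A + (norm x)\<^sup>2"
  have v: "v > 0" using A by (simp add: v_def add_pos_nonneg)
  have v_eq: "v = A + 1 * (x \<bullet> x)" by (simp add: v_def power2_norm_eq_inner)
  have "laplacian (\<lambda>x :: real ^ 'n. \<kappa> * (A + 1 * (x \<bullet> x)) powr a) x
    = (\<kappa> * (a * v powr (a - 1))) * laplacian (\<lambda>x :: real ^ 'n. A + 1 * (x \<bullet> x)) x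
      + (\<kappa> * (a * ((a - 1) * v powr (a - 2)))) * (\<Sum>i\<in>UNIV. (partial_derivative i (\<lambda>x :: real ^ 'n. A + 1 * (x \<bullet> x)) x)\<^sup>2)"
    unfolding v_eq
  proof (rule laplacian_compose[where S = "{0<..}" and v = "\<lambda>x. A + 1 * (x \<bullet> x)" and g = "\<lambda>t. \<kappa> * t powr a"
          and g' = "\<lambda>t. \<kappa> * (a * t powr (a - 1))" and g'' = "\<lambda>t. \<kappa> * (a * ((a - 1) * t powr (a - 2)))"])
    show "A + 1 * (y \<bullet> y) \<in> {0<..}" for y :: "real ^ 'n" using A by (simp add: add_pos_nonneg)
    fix t :: real assume "t \<in> {0<..}"
    then show "((\<lambda>t. \<kappa> * t powr a) has_real_derivative \<kappa> * (a * t powr (a - 1))) (at t)"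
      "((\<lambda>t. \<kappa> * (a * t powr (a - 1))) has_real_derivative \<kappa> * (a * ((a - 1) * t powr (a - 2)))) (at t)"
      by (auto intro!: derivative_eq_intros)
  qed (rule smooth_fun_quadratic)
  also have "(\<Sum>i\<in>UNIV. (partial_derivative i (\<lambda>x :: real ^ 'n. A + 1 * (x \<bullet> x)) x)\<^sup>2) = 4 * (norm x)\<^sup>2"
    unfolding partial_derivative_quadratic
    by (simp add: power_mult_distrib sum_distrib_left[symmetric] power2_norm_eq_inner inner_vec_def)
       (simp add: power2_eq_square)
  also have "laplacian (\<lambda>x :: real ^ 'n. A + 1 * (x \<bullet> x)) x = 2 * real CARD('n)"
    unfolding laplacian_quadratic by simp
  also have "(\<kappa> * (a * ((a - 1) * v powr (a - 2)))) * (4 * (norm x)\<^sup>2)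
      \<le> (\<kappa> * (a * ((a - 1) * v powr (a - 2)))) * (4 * v)"
  proof (intro mult_left_mono)
    have "0 \<le> a * (a - 1)" using \<beta> by (intro mult_nonpos_nonpos) (simp_all add: a_def)
    then have "0 \<le> \<kappa> * ((a * (a - 1)) * v powr (a - 2))" using \<kappa> by simp
    then show "0 \<le> \<kappa> * (a * ((a - 1) * v powr (a - 2)))" by (simp only: mult.assoc)
  qed (use A in \<open>simp_all add: v_def\<close>)
  also have "v powr (a - 2) = v powr (a - 1) / v"
    using v by (simp add: powr_diff power2_eq_square)
  also have "\<kappa> * (a * v powr (a - 1)) * (2 * real CARD('n)) + \<kappa> * (a * ((a - 1) * (v powr (a - 1) / v))) * (4 * v)
    = (\<kappa> * v powr (a - 1)) * (\<beta> * (\<beta> + 2 - real CARD('n)))"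
    using v by (simp add: a_def field_simps)
  also have "\<dots> \<le> (\<kappa> * v powr (a - 1)) * (\<beta> * 2)"
    using \<beta> \<kappa> by (intro mult_left_mono) auto
  finally show ?thesis by (simp add: a_def v_def power2_norm_eq_inner mult_ac)
qed

lemma L2s_bounded_continuous:
  fixes u :: "real ^ 'n::finite \<Rightarrow> real"
  assumes n: "CARD('n) \<ge> 2" and s: "0 < s" "s < 1" and u: "continuous_on UNIV u" "\<And>x. \<bar>u x\<bar> \<le> B"
  shows "L2s s u"
proof -
  let ?p = "real CARD('n) + 2 * s"
  have "L1_loc u"
    unfolding L1_loc_def
  proof (intro allI impI)
    fix K :: "(real ^ 'n) set" assume K: "compact K"
    show "u absolutely_integrable_on K"
      unfolding set_integrable_def using borel_integrable_compact[OF K continuous_on_subset[OF u(1) subset_UNIV]]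
      by (simp add: integrable_completion indicator_def if_distrib[of "\<lambda>c. c * _"] cong: if_cong)
  qed
  moreover have [measurable]: "u \<in> borel_measurable borel" using u(1) by (rule borel_measurable_continuous_onI)
  have B: "B \<ge> 0" using u(2)[of 0] by simp
  have "integrable lborel (\<lambda>x. \<bar>u x\<bar> / (1 + norm x powr ?p))"
  proof (rule Bochner_Integration.integrable_bound)
    show "integrable lborel (\<lambda>h :: real ^ 'n. B * fractional_kernel s h)"
      using integrable_fractional_kernel_vec[OF s] by (intro integrable_mult_right)
    have "norm (\<bar>u x\<bar> / (1 + norm x powr ?p)) \<le> norm (B * fractional_kernel s x)" if "x \<noteq> 0" for x
    proof -
      have pos: "norm x powr ?p > 0" "1 + norm x powr ?p > 0" using that by (auto intro: add_pos_nonneg)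
      have "norm x powr ?p \<le> min 1 ((norm x)\<^sup>2) * (1 + norm x powr ?p)"
      proof (cases "norm x \<le> 1")
        case True
        have "norm x powr ?p \<le> norm x powr 2"
          using True n s by (intro powr_mono') auto
        also have "\<dots> \<le> (norm x)\<^sup>2 * (1 + norm x powr ?p)"
          using that by (simp add: algebra_simps)
        finally show ?thesis using True by (simp add: power_le_one min_absorb2)
      next
        case False
        then have "1 \<le> (norm x)\<^sup>2" by (simp add: one_le_power)
        then show ?thesis by (simp add: min_absorb1)
      qed
      then have "1 / (1 + norm x powr ?p) \<le> fractional_kernel s x"
        by (simp only: pos_divide_le_eq[OF pos(2)] times_divide_eq_left pos_le_divide_eq[OF pos(1)] mult_1)
      then have "\<bar>u x\<bar> * (1 / (1 + norm x powr ?p)) \<le> B * fractional_kernel s x"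
        using u(2) B pos by (intro mult_mono) auto
      then show ?thesis using B pos by simp
    qed
    then show "AE x in lborel. norm (\<bar>u x\<bar> / (1 + norm x powr ?p)) \<le> norm (B * fractional_kernel s x)"
      using AE_lborel_singleton[of "0 :: real ^ 'n"] by (auto elim!: eventually_mono)
  qed measurable
  then have "integrable lebesgue (\<lambda>x. \<bar>u x\<bar> / (1 + norm x powr ?p))"
    by (subst integrable_completion) measurable
  ultimately show ?thesis by (simp add: L2s_def)
qed

text \<open>
  Since \<open>M \<ge> \<surd>A\<close>, the Laplacian of \<open>w\<close> is smaller than the lower bound for the fractional Laplacian by a
  factor of order \<open>A\<close> to the power \<open>s - 1\<close>; the constant \<open>A\<close> is chosen so that half of the fractional
  term survives. As \<open>\<beta> q = \<beta> + 2 s\<close>, both sides then decay like the same power of \<open>M\<close>, and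
  \<open>\<kappa>\<close> is the amplitude for which the remaining constants are equal.
\<close>
theorem exists_positive_classical_supersolution:
  fixes s q :: real
  assumes n: "CARD('n::finite) \<ge> 3" and s: "0 < s" "s < 1"
    and q: "q > real CARD('n) / (real CARD('n) - 2 * s)"
  shows "\<exists>u :: real ^ 'n \<Rightarrow> real. smooth_fun u \<and> bounded (range u) \<and> positive_classical_supersolution s q u"
proof -
  let ?n = "real CARD('n)"
  define \<beta> where "\<beta> = 2 * s / (q - 1)"
  have ns: "?n - 2 * s > 0" using n s by linarith
  have q1: "q > 1"
  proof -
    have "1 < ?n / (?n - 2 * s)" using ns s by simp
    then show ?thesis using q by linarith
  qed
  have "?n < q * (?n - 2 * s)" using q ns by (simp add: pos_divide_less_eq)
  then have "2 * s < (q - 1) * (?n - 2 * s)" by (simp add: algebra_simps)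
  then have \<beta>: "0 < \<beta>" "\<beta> < ?n - 2 * s"
    using q1 s by (simp_all add: \<beta>_def pos_divide_less_eq mult.commute)
  have \<beta>q: "\<beta> * q = \<beta> + 2 * s" using q1 by (simp add: \<beta>_def field_simps)
  define c where "c = (1 - 2 powr (- (?n - 2 * s - \<beta>))) * (1 - 2 powr (- \<beta>)) * 4 powr (- (?n + 2 * s))
      * (unit_ball_vol ?n / 2 ^ CARD('n))"
  define c' where "c' = frac_const CARD('n) s * c"
  have pw: "2 powr (- r) < (1::real)" if "r > 0" for r
    using powr_less_mono[of "- r" 0 2] that by simp
  have "c > 0" unfolding c_def using pw[OF \<beta>(1)] pw[of "?n - 2 * s - \<beta>"] \<beta> by simp
  then have c': "c' > 0" unfolding c'_def using frac_const_pos[OF s] by simp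
  have "((\<lambda>A. A powr (s - 1)) \<longlongrightarrow> 0) at_top"
    using s by (intro tendsto_neg_powr filterlim_ident) auto
  then have "\<forall>\<^sub>F A in at_top. A powr (s - 1) < c' / (4 * \<beta>)"
    by (rule order_tendstoD) (use c' \<beta> in simp)
  then obtain A0 where A0: "\<And>A. A \<ge> A0 \<Longrightarrow> A powr (s - 1) < c' / (4 * \<beta>)"
    by (auto simp: eventually_at_top_linorder)
  define A where "A = max 1 A0"
  have A1: "A \<ge> 1" and As: "2 * \<beta> * A powr (s - 1) \<le> c' / 2"
    using A0[of A] \<beta> by (auto simp: A_def field_simps)
  define \<kappa> where "\<kappa> = (c' / 2) powr (1 / (q - 1))"
  have \<kappa>: "\<kappa> > 0" using c' by (simp add: \<kappa>_def)
  have \<kappa>q: "\<kappa> powr q = \<kappa> * (c' / 2)"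
  proof -
    have "\<kappa> powr (q - 1) = c' / 2" using c' q1 by (simp add: \<kappa>_def powr_powr)
    then show ?thesis using \<kappa> powr_add[of \<kappa> 1 "q - 1"] by simp
  qed
  define w :: "real ^ 'n \<Rightarrow> real" where "w x = (A + (norm x)\<^sup>2) powr (- \<beta> / 2)" for x
  define u where "u x = \<kappa> * w x" for x
  have w_smooth: "smooth_fun w" unfolding w_def[abs_def] using A1 by (intro smooth_fun_profile) simp
  then have u_smooth: "smooth_fun u"
    unfolding u_def[abs_def] by (auto simp: smooth_fun_def intro!: Ck_mult Ck_const)
  have Ax: "A + (norm x)\<^sup>2 \<ge> 1" for x :: "real ^ 'n" using A1 by (simp add: add_increasing2)
  have w_pos: "w x > 0" for x using Ax[of x] by (simp add: w_def)
  have w_le: "\<bar>w x\<bar> \<le> 1" for x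
  proof -
    have "w x \<le> 1 powr (- \<beta> / 2)"
      unfolding w_def using Ax \<beta> by (intro powr_mono2') auto
    then show ?thesis using w_pos[of x] by simp
  qed
  have u_le: "\<bar>u x\<bar> \<le> \<kappa>" for x using w_le[of x] w_pos[of x] \<kappa> by (simp add: u_def abs_mult)
  have super: "u x powr q \<le> - laplacian u x + frac_laplacian s u x" for x
  proof -
    define M where "M = sqrt (A + (norm x)\<^sup>2)"
    have M: "M \<ge> 1" "M\<^sup>2 = A + (norm x)\<^sup>2" "M > 0" using Ax[of x] by (auto simp: M_def intro: less_le_trans[of 0 1])
    have wM: "(A + (norm x)\<^sup>2) powr r = M powr (2 * r)" for r
      unfolding M(2)[symmetric] using M by (simp add: powr_powr[symmetric])
    have "c * M powr (- \<beta> - 2 * s) \<le> (LINT h|lborel. fraclap_quotient s w x h)"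
    proof (rule tendsto_lowerbound[OF truncated_fraclap_tendsto_smooth[OF s w_smooth w_le]])
      have "\<forall>\<^sub>F \<epsilon>::real in at_right 0. 0 < \<epsilon> \<and> \<epsilon> \<le> 1"
        by (auto simp: eventually_at_right_field intro!: exI[of _ 1])
      then show "\<forall>\<^sub>F \<epsilon> in at_right 0. c * M powr (- \<beta> - 2 * s) \<le> truncated_fraclap s w x \<epsilon>"
        by eventually_elim
          (use truncated_fraclap_profile_lower[OF s A1 \<beta> _ _ w_smooth w_def] in \<open>simp add: c_def M_def\<close>)
    qed simp
    then have "c' * M powr (- \<beta> - 2 * s) \<le> frac_laplacian s w x"
      unfolding frac_laplacian_smooth[OF s w_smooth w_le] c'_def mult.assoc
      using less_imp_le[OF frac_const_pos[OF s, of "CARD('n)"]] by (intro mult_left_mono)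
    then have frac: "\<kappa> * (c' * M powr (- \<beta> - 2 * s)) \<le> frac_laplacian s u x"
      unfolding u_def[abs_def] frac_laplacian_cmult[OF s w_smooth w_le]
      using \<kappa> by (intro mult_left_mono) auto
    have "laplacian u x \<le> 2 * \<kappa> * \<beta> * (A + (norm x)\<^sup>2) powr (- \<beta> / 2 - 1)"
      unfolding u_def[abs_def] w_def using A1 \<kappa> \<beta> s by (intro laplacian_profile_le) auto
    also have "(A + (norm x)\<^sup>2) powr (- \<beta> / 2 - 1) = M powr (- \<beta> - 2 * s) * (A + (norm x)\<^sup>2) powr (s - 1)"
      unfolding wM by (simp add: powr_add[symmetric] algebra_simps)
    also have "2 * \<kappa> * \<beta> * (M powr (- \<beta> - 2 * s) * (A + (norm x)\<^sup>2) powr (s - 1))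
        \<le> 2 * \<kappa> * \<beta> * (M powr (- \<beta> - 2 * s) * A powr (s - 1))"
      using \<kappa> \<beta> A1 s by (intro mult_left_mono powr_mono2') auto
    also have "\<dots> = \<kappa> * M powr (- \<beta> - 2 * s) * (2 * \<beta> * A powr (s - 1))" by simp
    also have "\<dots> \<le> \<kappa> * M powr (- \<beta> - 2 * s) * (c' / 2)"
      using As \<kappa> by (intro mult_left_mono) auto
    finally have lap: "laplacian u x \<le> \<kappa> * M powr (- \<beta> - 2 * s) * (c' / 2)" .
    have "u x powr q = \<kappa> powr q * M powr (- \<beta> * q)"
      using \<kappa> by (simp add: u_def w_def wM powr_mult powr_powr)
    also have "- \<beta> * q = - \<beta> - 2 * s" using \<beta>q by simp
    also have "\<kappa> powr q * M powr (- \<beta> - 2 * s) = \<kappa> * M powr (- \<beta> - 2 * s) * (c' / 2)" by (simp add: \<kappa>q)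
    finally show ?thesis using lap frac by (simp add: algebra_simps)
  qed
  have "Ck 2 u" using u_smooth by (simp add: smooth_fun_def)
  moreover have "L2s s u"
    using n by (intro L2s_bounded_continuous[OF _ s smooth_fun_continuous[OF u_smooth] u_le]) simp
  moreover have "u x > 0" for x using \<kappa> w_pos by (simp add: u_def)
  ultimately have "positive_classical_supersolution s q u"
    unfolding positive_classical_supersolution_def using super by blast
  moreover have "bounded (range u)" using u_le by (auto simp: bounded_iff)
  ultimately show ?thesis using u_smooth by blast
qed

section \<open>Cutoff functions\<close>

lemma tendsto_poly_div_exp_0: "((\<lambda>y. poly P y / exp y) \<longlongrightarrow> (0::real)) at_top"
proof -
  have "((\<lambda>y. \<Sum>i\<le>degree P. coeff P i * (y ^ i / exp y)) \<longlongrightarrow> (\<Sum>i\<le>degree P. coeff P i * 0)) at_top"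
    by (intro tendsto_sum tendsto_mult tendsto_const tendsto_power_div_exp_0)
  then show ?thesis by (simp add: poly_altdef sum_divide_distrib)
qed

text \<open>
  The derivatives of the flat function \<open>exp (- 1 / t)\<close> (extended by \<open>0\<close>) are of this form, with a polynomial
  in \<open>1 / t\<close> as a factor.
\<close>
definition flat_fun :: "real poly \<Rightarrow> real \<Rightarrow> real" where
  "flat_fun P t = (if t > 0 then poly P (1 / t) * exp (- (1 / t)) else 0)"

lemma DERIV_flat_fun:
  "(flat_fun P has_real_derivative flat_fun (monom 1 2 * (P - pderiv P)) t) (at t)"
proof -
  consider "t > 0" | "t < 0" | "t = 0" by linarith
  then show ?thesis
  proof cases
    case 1
    have "((\<lambda>t. poly P (1 / t) * exp (- (1 / t))) has_real_derivative
        poly (monom 1 2 * (P - pderiv P)) (1 / t) * exp (- (1 / t))) (at t)"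
      using 1 by (auto intro!: derivative_eq_intros DERIV_chain2[OF poly_DERIV]
          simp: poly_monom field_simps power2_eq_square)
    then show ?thesis
    proof (rule DERIV_cong_ev[THEN iffD1, OF refl _ _, rotated -1])
      show "\<forall>\<^sub>F t in nhds t. poly P (1 / t) * exp (- (1 / t)) = flat_fun P t"
        using eventually_nhds_in_open[of "{0<..}" t] 1 by (auto elim!: eventually_mono simp: flat_fun_def)
      show "poly (monom 1 2 * (P - pderiv P)) (1 / t) * exp (- (1 / t)) = flat_fun (monom 1 2 * (P - pderiv P)) t"
        using 1 by (simp add: flat_fun_def)
    qed
  next
    case 2
    have "((\<lambda>t. 0) has_real_derivative 0) (at t)" by simp
    then show ?thesis
    proof (rule DERIV_cong_ev[THEN iffD1, OF refl _ _, rotated -1])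
      show "\<forall>\<^sub>F t in nhds t. 0 = flat_fun P t"
        using eventually_nhds_in_open[of "{..<0}" t] 2 by (auto elim!: eventually_mono simp: flat_fun_def)
    qed (use 2 in \<open>simp add: flat_fun_def\<close>)
  next
    case 3
    have "((\<lambda>h. flat_fun P h / h) \<longlongrightarrow> 0) (at 0)"
    proof (rule filterlim_split_at)
      have "\<forall>\<^sub>F h::real in at_left 0. 0 = flat_fun P h / h"
        by (auto simp: eventually_at_left_field flat_fun_def intro!: exI[of _ "- 1"])
      then show "((\<lambda>h. flat_fun P h / h) \<longlongrightarrow> 0) (at_left 0)"
        by (rule Lim_transform_eventually[OF tendsto_const])
      have "((\<lambda>y. poly (P * [:0, 1:]) y / exp y) \<longlongrightarrow> 0) at_top"
        by (rule tendsto_poly_div_exp_0)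
      moreover have "\<forall>\<^sub>F y::real in at_top. poly (P * [:0, 1:]) y / exp y = flat_fun P (inverse y) / inverse y"
        using eventually_gt_at_top[of 0]
        by eventually_elim (simp add: flat_fun_def exp_minus field_simps)
      ultimately show "((\<lambda>h. flat_fun P h / h) \<longlongrightarrow> 0) (at_right 0)"
        unfolding filterlim_at_right_to_top by (rule Lim_transform_eventually)
    qed
    then show ?thesis using 3 by (simp add: DERIV_def flat_fun_def)
  qed
qed

definition bump :: "real ^ 'n::finite \<Rightarrow> real" where
  "bump x = flat_fun 1 (1 - (norm x)\<^sup>2)"

lemma smooth_fun_bump: "smooth_fun (bump :: real ^ 'n::finite \<Rightarrow> real)"
proof -
  have "smooth_fun (\<lambda>x :: real ^ 'n. flat_fun 1 (1 + (- 1) * (x \<bullet> x)))"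
  proof (rule smooth_fun_compose[where F = "range flat_fun" and S = UNIV and g = "flat_fun 1"
          and v = "\<lambda>x. 1 + (- 1) * (x \<bullet> x)"])
    fix g assume "g \<in> range flat_fun"
    then obtain P where "g = flat_fun P" by blast
    then show "\<exists>g'\<in>range flat_fun. \<forall>t\<in>UNIV. (g has_real_derivative g' t) (at t)"
      using DERIV_flat_fun by blast
  qed (auto intro: smooth_fun_quadratic[of 1 "- 1", simplified])
  then show ?thesis by (simp add: bump_def[abs_def] power2_norm_eq_inner)
qed

lemma bump_nonneg: "0 \<le> bump x" and bump_le_1: "bump x \<le> 1"
  by (auto simp: bump_def flat_fun_def)

lemma abs_bump_le_1: "\<bar>bump x\<bar> \<le> 1"
  using bump_nonneg[of x] bump_le_1[of x] by simp

lemma bump_eq_0: "norm x \<ge> 1 \<Longrightarrow> bump x = 0"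
  by (simp add: bump_def flat_fun_def not_less one_le_power)

lemma bump_lower:
  assumes "norm x \<le> 1 / 2" shows "exp (- (4 / 3)) \<le> bump x"
proof -
  have "(norm x)\<^sup>2 \<le> (1 / 2)\<^sup>2" using assms by (intro power_mono) auto
  then have *: "3 / 4 \<le> 1 - (norm x)\<^sup>2" by (simp add: power2_eq_square)
  then have "1 / (1 - (norm x)\<^sup>2) \<le> 4 / 3" by (simp add: divide_le_eq)
  then show ?thesis using * by (simp add: bump_def flat_fun_def)
qed

text \<open>
  The graph of a convex power lies above its tangent at \<open>a\<close>.
\<close>
lemma power_tangent_le:
  fixes a b :: real
  assumes "a \<ge> 0" "b \<ge> 0"
  shows "a ^ Suc k - b ^ Suc k \<le> real (Suc k) * a ^ k * (a - b)"
proof (induction k)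
  case (Suc k)
  have "real (Suc (Suc k)) * a ^ Suc k * (a - b) - (a ^ Suc (Suc k) - b ^ Suc (Suc k))
    = b * (real (Suc k) * a ^ k * (a - b) - (a ^ Suc k - b ^ Suc k)) + real (Suc k) * a ^ k * (a - b)\<^sup>2"
    by (simp add: algebra_simps power2_eq_square)
  also have "\<dots> \<ge> 0" using Suc assms by simp
  finally show ?case by linarith
qed simp

text \<open>
  The chain rule produces in addition only a nonnegative multiple of the squared gradient.
\<close>
lemma laplacian_power_ge:
  fixes u :: "real ^ 'n::finite \<Rightarrow> real"
  assumes u: "smooth_fun u" "\<And>x. u x \<ge> 0"
  shows "real (Suc k) * u x ^ k * laplacian u x \<le> laplacian (\<lambda>x. u x ^ Suc k) x"
proof -
  have "laplacian (\<lambda>x. u x ^ Suc k) x = (real (Suc k) * u x ^ k) * laplacian u x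
    + (real (Suc k) * (real k * u x ^ (k - 1))) * (\<Sum>i\<in>UNIV. (partial_derivative i u x)\<^sup>2)"
  proof (rule laplacian_compose[where S = UNIV and v = u and g = "\<lambda>t. t ^ Suc k"
        and g' = "\<lambda>t. real (Suc k) * t ^ k" and g'' = "\<lambda>t. real (Suc k) * (real k * t ^ (k - 1))"])
    fix t :: real
    show "((\<lambda>t. t ^ Suc k) has_real_derivative real (Suc k) * t ^ k) (at t)"
      "((\<lambda>t. real (Suc k) * t ^ k) has_real_derivative real (Suc k) * (real k * t ^ (k - 1))) (at t)"
      using DERIV_pow[of "Suc k" t] DERIV_cmult[OF DERIV_pow[of k t], of "real (Suc k)"] by simp_all
  qed (use u in auto)
  moreover have "0 \<le> (real (Suc k) * (real k * u x ^ (k - 1))) * (\<Sum>i\<in>UNIV. (partial_derivative i u x)\<^sup>2)"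
    using u by (intro mult_nonneg_nonneg sum_nonneg) auto
  ultimately show ?thesis by linarith
qed

text \<open>
  The tangent inequality holds for each difference under the integral, hence for the integral.
\<close>
lemma frac_laplacian_power_le:
  fixes u :: "real ^ 'n::finite \<Rightarrow> real"
  assumes s: "0 < s" "s < 1" and u: "smooth_fun u" "\<And>x. u x \<ge> 0" "\<And>x. u x \<le> 1"
  shows "frac_laplacian s (\<lambda>x. u x ^ Suc k) x \<le> real (Suc k) * u x ^ k * frac_laplacian s u x"
proof -
  have v: "smooth_fun (\<lambda>x. u x ^ Suc k)" "\<And>y. \<bar>u y ^ Suc k\<bar> \<le> 1"
    using u smooth_fun_power[OF u(1), of "Suc k"] by (auto intro!: power_le_one mult_le_one)
  have u': "\<And>y. \<bar>u y\<bar> \<le> 1" using u by simp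
  have "(LINT h|lborel. fraclap_quotient s (\<lambda>x. u x ^ Suc k) x h)
      \<le> (LINT h|lborel. real (Suc k) * u x ^ k * fraclap_quotient s u x h)"
  proof (rule integral_mono)
    show "integrable lborel (fraclap_quotient s (\<lambda>x. u x ^ Suc k) x)"
      by (rule integrable_fraclap_quotient_smooth[OF s v])
    show "integrable lborel (\<lambda>h. real (Suc k) * u x ^ k * fraclap_quotient s u x h)"
      by (intro integrable_mult_right integrable_fraclap_quotient_smooth[OF s u(1) u'])
    fix h
    have "2 * u x ^ Suc k - u (x + h) ^ Suc k - u (x - h) ^ Suc k
        = (u x ^ Suc k - u (x + h) ^ Suc k) + (u x ^ Suc k - u (x - h) ^ Suc k)" by simp
    also have "\<dots> \<le> real (Suc k) * u x ^ k * (u x - u (x + h)) + real (Suc k) * u x ^ k * (u x - u (x - h))"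
      by (intro add_mono power_tangent_le u)
    also have "\<dots> = real (Suc k) * u x ^ k * (2 * u x - u (x + h) - u (x - h))"
    proof -
      have "m * (a - b) + m * (a - c) = m * (2 * a - b - c)" for m a b c :: real
        by (simp add: algebra_simps)
      then show ?thesis .
    qed
    finally show "fraclap_quotient s (\<lambda>x. u x ^ Suc k) x h \<le> real (Suc k) * u x ^ k * fraclap_quotient s u x h"
      unfolding fraclap_quotient_def times_divide_eq_right by (rule divide_right_mono) simp
  qed
  also have "\<dots> = real (Suc k) * u x ^ k * (LINT h|lborel. fraclap_quotient s u x h)" by simp
  finally have "frac_const CARD('n) s * (LINT h|lborel. fraclap_quotient s (\<lambda>x. u x ^ Suc k) x h)
      \<le> frac_const CARD('n) s * (real (Suc k) * u x ^ k * (LINT h|lborel. fraclap_quotient s u x h))"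
    using less_imp_le[OF frac_const_pos[OF s, of "CARD('n)"]] by (rule mult_left_mono)
  then show ?thesis
    unfolding frac_laplacian_smooth[OF s v] frac_laplacian_smooth[OF s u(1) u'] by (simp only: mult_ac)
qed

lemma frac_laplacian_scale:
  fixes u :: "real ^ 'n::finite \<Rightarrow> real"
  assumes s: "0 < s" "s < 1" and u: "smooth_fun u" "\<And>y. \<bar>u y\<bar> \<le> B" and R: "R > 0"
  shows "frac_laplacian s (\<lambda>x. u ((1 / R) *\<^sub>R x)) x = R powr (- 2 * s) * frac_laplacian s u ((1 / R) *\<^sub>R x)"
proof -
  let ?p = "real CARD('n) + 2 * s"
  let ?q = "fraclap_quotient s u ((1 / R) *\<^sub>R x)"
  have [measurable]: "u \<in> borel_measurable borel"
    using smooth_fun_continuous[OF u(1)] by (rule borel_measurable_continuous_onI)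
  have "fraclap_quotient s (\<lambda>x. u ((1 / R) *\<^sub>R x)) x h = R powr (- ?p) * ?q (0 + (1 / R) *\<^sub>R h)" for h
  proof -
    have H: "norm ((1 / R) *\<^sub>R h) powr ?p = norm h powr ?p / R powr ?p"
      using R by (simp add: powr_divide)
    have eq: "N / (2 * H) = 1 / Q * (N / (2 * (H / Q)))" if "Q \<noteq> 0" for N H Q :: real
      using that by simp
    have Q: "R powr ?p \<noteq> 0" using R by simp
    show ?thesis
      unfolding fraclap_quotient_def powr_minus_divide scaleR_add_right scaleR_diff_right add_0_left H
      by (rule eq[OF Q])
  qed
  then have "(LINT h|lborel. fraclap_quotient s (\<lambda>x. u ((1 / R) *\<^sub>R x)) x h)
      = R powr (- ?p) * (LINT h|lborel. ?q (0 + (1 / R) *\<^sub>R h))" by simp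
  also have "(LINT h|lborel. ?q (0 + (1 / R) *\<^sub>R h)) = R ^ CARD('n) * (LINT h|lborel. ?q h)"
  proof -
    have "?q \<in> borel_measurable borel" unfolding fraclap_quotient_def[abs_def] by measurable
    from integral_lborel_affine[OF _ this, of "1 / R" 0] show ?thesis
      using R by (simp add: power_divide)
  qed
  also have "R powr (- ?p) * (R ^ CARD('n) * (LINT h|lborel. ?q h)) = R powr (- 2 * s) * (LINT h|lborel. ?q h)"
  proof -
    have "R powr (- ?p) * R ^ CARD('n) = R powr (- 2 * s)"
      using R by (simp add: powr_realpow[symmetric] powr_add[symmetric])
    then show ?thesis by (simp only: mult.assoc[symmetric])
  qed
  finally have "(LINT h|lborel. fraclap_quotient s (\<lambda>x. u ((1 / R) *\<^sub>R x)) x h) = R powr (- 2 * s) * (LINT h|lborel. ?q h)" .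
  then show ?thesis
    unfolding frac_laplacian_smooth[OF s u] frac_laplacian_smooth[OF s smooth_fun_scale[OF u(1)] u(2)] by simp
qed

text \<open>
  Only points of the closed unit ball matter: elsewhere a power of the bump vanishes, and so does the right
  side of the convexity inequality. This makes compactness of a ball of radius \<open>2\<close> sufficient for
  the uniform bound on second derivatives.
\<close>
lemma bump_operator_bounded:
  assumes s: "0 < s" "s < 1"
  obtains D where "D \<ge> 0"
    "\<And>x :: real ^ 'n::finite. norm x \<le> 1 \<Longrightarrow> \<bar>laplacian bump x\<bar> \<le> D"
    "\<And>x :: real ^ 'n. norm x \<le> 1 \<Longrightarrow> \<bar>frac_laplacian s bump x\<bar> \<le> D"
proof -
  obtain K where K: "\<And>z i j. z \<in> cball (0 :: real ^ 'n) 2 \<Longrightarrow>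
      \<bar>partial_derivative j (partial_derivative i bump) z\<bar> \<le> K"
    using bounded_second_partials[OF smooth_fun_bump compact_cball] by blast
  define C where "C = \<bar>2 * (real CARD('n))\<^sup>2 * K\<bar> + 4 * 1"
  define D1 where "D1 = frac_const CARD('n) s * (LINT h|lborel. C * fractional_kernel s (h :: real ^ 'n))"
  have lap: "\<bar>laplacian bump x\<bar> \<le> real CARD('n) * K" if "norm x \<le> 1" for x :: "real ^ 'n"
  proof -
    have "\<bar>laplacian bump x\<bar> \<le> (\<Sum>i\<in>(UNIV :: 'n set). K)"
      unfolding laplacian_def using that by (intro order_trans[OF sum_abs] sum_mono K) auto
    then show ?thesis by simp
  qed
  have frac: "\<bar>frac_laplacian s bump x\<bar> \<le> D1" if x: "norm x \<le> 1" for x :: "real ^ 'n"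
  proof -
    have "cball x 1 \<subseteq> cball 0 2"
    proof
      fix z assume "z \<in> cball x 1"
      then show "z \<in> cball 0 2" using x norm_triangle_ineq2[of z x] by (simp add: dist_norm norm_minus_commute)
    qed
    then have K1: "\<And>z i j. z \<in> cball x 1 \<Longrightarrow> \<bar>partial_derivative j (partial_derivative i bump) z\<bar> \<le> K"
      using K by blast
    note K2 = second_difference_le[OF smooth_fun_bump K1]
    have "\<bar>LINT h|lborel. fraclap_quotient s bump x h\<bar> \<le> (LINT h|lborel. \<bar>fraclap_quotient s bump x h\<bar>)"
      by (rule integral_abs_bound)
    also have "\<dots> \<le> (LINT h|lborel. C * fractional_kernel s (h :: real ^ 'n))"
    proof (rule integral_mono)
      show "integrable lborel (\<lambda>h. \<bar>fraclap_quotient s bump x h\<bar>)"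
        by (intro integrable_abs integrable_fraclap_quotient_smooth[OF s smooth_fun_bump abs_bump_le_1])
      show "integrable lborel (\<lambda>h :: real ^ 'n. C * fractional_kernel s h)"
        by (intro integrable_mult_right integrable_fractional_kernel_vec s)
      show "\<bar>fraclap_quotient s bump x h\<bar> \<le> C * fractional_kernel s h" for h
        unfolding C_def
        by (rule abs_fraclap_quotient_le[OF s smooth_fun_continuous[OF smooth_fun_bump] abs_bump_le_1 K2])
    qed
    finally show ?thesis
      unfolding frac_laplacian_smooth[OF s smooth_fun_bump abs_bump_le_1] D1_def abs_mult
      using frac_const_pos[OF s, of "CARD('n)"] by (simp add: mult_left_mono)
  qed
  have "\<bar>laplacian (bump :: real ^ 'n \<Rightarrow> real) 0\<bar> \<le> real CARD('n) * K" by (rule lap) simp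
  then show ?thesis
    by (intro that[of "max (real CARD('n) * K) D1"]) (auto simp: le_max_iff_disj dest: lap frac)
qed

definition cutoff :: "real \<Rightarrow> real ^ 'n::finite \<Rightarrow> real" where
  "cutoff R x = bump ((1 / R) *\<^sub>R x)"

lemma cutoff_props:
  shows "0 \<le> cutoff R x" "cutoff R x \<le> 1" "smooth_fun (cutoff R)"
    and "R > 0 \<Longrightarrow> norm x \<ge> R \<Longrightarrow> cutoff R x = 0"
    and "R > 0 \<Longrightarrow> norm x \<le> R / 2 \<Longrightarrow> exp (- (4 / 3)) \<le> cutoff R x"
proof -
  show "0 \<le> cutoff R x" "cutoff R x \<le> 1" by (simp_all add: cutoff_def bump_nonneg bump_le_1)
  show "smooth_fun (cutoff R)"
    unfolding cutoff_def[abs_def] by (rule smooth_fun_scale[OF smooth_fun_bump])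
  show "R > 0 \<Longrightarrow> norm x \<ge> R \<Longrightarrow> cutoff R x = 0"
    unfolding cutoff_def by (intro bump_eq_0) (simp add: field_simps)
  show "R > 0 \<Longrightarrow> norm x \<le> R / 2 \<Longrightarrow> exp (- (4 / 3)) \<le> cutoff R x"
    unfolding cutoff_def by (intro bump_lower) (simp add: field_simps)
qed

lemma test_function_cutoff_power:
  assumes R: "R > 0"
  shows "test_function (\<lambda>x :: real ^ 'n::finite. cutoff R x ^ Suc k)"
proof -
  have "{x :: real ^ 'n. cutoff R x ^ Suc k \<noteq> 0} \<subseteq> cball 0 R"
  proof (rule subsetI, rule ccontr)
    fix x :: "real ^ 'n" assume x: "x \<in> {x. cutoff R x ^ Suc k \<noteq> 0}" "x \<notin> cball 0 R"
    then have "cutoff R x = 0" by (intro cutoff_props(4)[OF R]) simp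
    then show False using x(1) by simp
  qed
  then have "closure {x :: real ^ 'n. cutoff R x ^ Suc k \<noteq> 0} \<subseteq> cball 0 R"
    by (rule closure_minimal) simp
  then have "bounded (closure {x :: real ^ 'n. cutoff R x ^ Suc k \<noteq> 0})"
    by (rule bounded_subset[OF bounded_cball])
  then have "compact (closure {x :: real ^ 'n. cutoff R x ^ Suc k \<noteq> 0})"
    by (simp only: compact_eq_bounded_closed closed_closure simp_thms)
  then show ?thesis unfolding test_function_def using smooth_fun_power[OF cutoff_props(3)] by blast
qed

text \<open>
  The convexity inequality combined with scaling: the Laplacian of the cutoff is of order \<open>R\<^sup>-\<^sup>2\<close>, which
  for \<open>R \<ge> 1\<close> is at most the order \<open>R\<^sup>-\<^sup>2\<^sup>s\<close> of its fractional Laplacian.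
\<close>
lemma cutoff_operator_le:
  assumes s: "0 < s" "s < 1" and k: "k > 0"
  obtains D where "D > 0"
    "\<And>R (x :: real ^ 'n::finite). R \<ge> 1 \<Longrightarrow>
      - laplacian (\<lambda>x. cutoff R x ^ Suc k) x + frac_laplacian s (\<lambda>x. cutoff R x ^ Suc k) x
        \<le> D * R powr (- 2 * s) * cutoff R x ^ k"
proof -
  obtain D where D: "D \<ge> 0"
    "\<And>x :: real ^ 'n. norm x \<le> 1 \<Longrightarrow> \<bar>laplacian bump x\<bar> \<le> D"
    "\<And>x :: real ^ 'n. norm x \<le> 1 \<Longrightarrow> \<bar>frac_laplacian s bump x\<bar> \<le> D"
    using bump_operator_bounded[OF s] by blast
  show ?thesis
  proof (rule that)
    show "real (Suc k) * (2 * D + 1) > 0" using D by simp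
    fix R :: real and x :: "real ^ 'n" assume R: "R \<ge> 1"
    then have R0: "R > 0" by simp
    let ?y = "(1 / R) *\<^sub>R x"
    have "- laplacian (\<lambda>x. cutoff R x ^ Suc k) x + frac_laplacian s (\<lambda>x. cutoff R x ^ Suc k) x
        \<le> real (Suc k) * cutoff R x ^ k * (- laplacian (cutoff R) x + frac_laplacian s (cutoff R) x)"
    proof -
      have "m * (- a + b) = - (m * a) + m * b" for m a b :: real by (simp add: algebra_simps)
      note m = this
      show ?thesis unfolding m
        using laplacian_power_ge[OF cutoff_props(3) cutoff_props(1), of k R x]
          frac_laplacian_power_le[OF s cutoff_props(3) cutoff_props(1) cutoff_props(2), of R k x] by linarith
    qed
    also have "\<dots> \<le> real (Suc k) * cutoff R x ^ k * ((2 * D + 1) * R powr (- 2 * s))"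
    proof (cases "norm x \<ge> R")
      case True
      then show ?thesis using cutoff_props(4)[OF R0 True] k by (simp add: zero_power)
    next
      case False
      then have y: "norm ?y \<le> 1" using R0 by (simp add: field_simps)
      have "laplacian (cutoff R) x = (1 / R)\<^sup>2 * laplacian bump ?y"
        unfolding cutoff_def[abs_def] by (rule laplacian_scale[OF smooth_fun_bump])
      moreover have "(1 / R)\<^sup>2 \<le> R powr (- 2 * s)"
      proof -
        have "(1 / R)\<^sup>2 = R powr (- 2)" using R0 by (simp add: powr_minus_divide power_divide)
        also have "\<dots> \<le> R powr (- 2 * s)" using R s by (intro powr_mono) auto
        finally show ?thesis .
      qed
      ultimately have "\<bar>laplacian (cutoff R) x\<bar> \<le> R powr (- 2 * s) * D"
        using D(2)[OF y] D(1) by (simp only: abs_mult abs_power2) (intro mult_mono, auto)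
      moreover have "frac_laplacian s (cutoff R) x \<le> R powr (- 2 * s) * D"
      proof -
        have "frac_laplacian s (cutoff R) x = R powr (- 2 * s) * frac_laplacian s bump ?y"
          unfolding cutoff_def[abs_def] by (rule frac_laplacian_scale[OF s smooth_fun_bump abs_bump_le_1 R0])
        also have "\<dots> \<le> R powr (- 2 * s) * D" using D(3)[OF y] by (intro mult_left_mono) auto
        finally show ?thesis .
      qed
      ultimately have "- laplacian (cutoff R) x + frac_laplacian s (cutoff R) x
          \<le> R powr (- 2 * s) * D + R powr (- 2 * s) * D" by linarith
      also have "\<dots> \<le> (2 * D + 1) * R powr (- 2 * s)" by (simp add: algebra_simps)
      finally show ?thesis using cutoff_props(1)[of R x] by (intro mult_left_mono) auto
    qed
    finally show "- laplacian (\<lambda>x. cutoff R x ^ Suc k) x + frac_laplacian s (\<lambda>x. cutoff R x ^ Suc k) x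
        \<le> real (Suc k) * (2 * D + 1) * R powr (- 2 * s) * cutoff R x ^ k" by (simp only: mult_ac)
  qed
qed

section \<open>Nonexistence up to the critical exponent\<close>

text \<open>
  A form of Young's inequality in which either term can be made small. According to whether \<open>b\<close> is below
  or above \<open>\<Lambda>\<close> times \<open>a\<close> to the power \<open>q - 1\<close>, one of the two terms alone suffices.
\<close>
lemma young_ineq:
  fixes a b \<Lambda> q :: real
  assumes "a \<ge> 0" "b \<ge> 0" "\<Lambda> > 0" "q > 1"
  shows "a * b \<le> \<Lambda> * a powr q + \<Lambda> powr (- (1 / (q - 1))) * b powr (q / (q - 1))"
proof (cases "a = 0 \<or> b = 0")
  case True
  then show ?thesis using assms by auto
next
  case False
  then have pos: "a > 0" "b > 0" using assms by auto
  show ?thesis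
  proof (cases "b \<le> \<Lambda> * a powr (q - 1)")
    case True
    have "a * b \<le> a * (\<Lambda> * a powr (q - 1))" using True pos by (intro mult_left_mono) auto
    also have "\<dots> = \<Lambda> * a powr q" using pos powr_add[of a 1 "q - 1"] by simp
    finally show ?thesis by (simp add: add_increasing2)
  next
    case False
    then have "a powr (q - 1) \<le> b / \<Lambda>" using assms by (simp add: pos_le_divide_eq mult.commute)
    then have "(a powr (q - 1)) powr (1 / (q - 1)) \<le> (b / \<Lambda>) powr (1 / (q - 1))"
      using assms by (intro powr_mono2) auto
    then have "a \<le> (b / \<Lambda>) powr (1 / (q - 1))" using assms pos by (simp add: powr_powr)
    then have "a * b \<le> (b / \<Lambda>) powr (1 / (q - 1)) * b" using pos by (intro mult_right_mono) auto
    also have "\<dots> = \<Lambda> powr (- (1 / (q - 1))) * (b powr (1 / (q - 1)) * b powr 1)"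
      using pos assms by (simp add: powr_divide powr_minus_divide)
    also have "b powr (1 / (q - 1)) * b powr 1 = b powr (q / (q - 1))"
      unfolding powr_add[symmetric] using assms by (simp add: add_divide_eq_if_simps)
    finally show ?thesis using assms by (simp add: add_increasing)
  qed
qed

text \<open>
  Let \<open>J r\<close> be the integral of \<open>u\<^sup>q\<close> over the ball of radius \<open>r\<close> and \<open>T R\<close> its integral against the test
  function. The inequality \<open>upper\<close> splits the domain at radius \<open>M\<close>: inside, the factor \<open>R\<^sup>-\<^sup>2\<^sup>s\<close> in
  \<open>E R\<close> is kept; outside, Young's inequality is used. Taking \<open>M\<close> negative and \<open>\<Lambda> = 1/2\<close> bounds \<open>J\<close>. Then
  \<open>R \<rightarrow> \<infinity>\<close>, \<open>M \<rightarrow> \<infinity>\<close> and \<open>\<Lambda> \<rightarrow> \<infinity>\<close>, in this order, show that the limit of \<open>J\<close> is \<open>0\<close>.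
\<close>
theorem no_positive_distributional_supersolution:
  fixes s q :: real and u :: "real ^ 'n::finite \<Rightarrow> real"
  assumes n: "CARD('n) \<ge> 3" and s: "0 < s" "s < 1" and q1: "q > 1"
    and q: "q \<le> real CARD('n) / (real CARD('n) - 2 * s)"
  shows "\<not> positive_distributional_supersolution s q u"
proof
  assume super: "positive_distributional_supersolution s q u"
  let ?n = "real CARD('n)"
  have u_pos: "AE x in lebesgue. u x > 0"
    and u_int: "\<And>r. integrable lebesgue (\<lambda>x. indicator (cball 0 r) x * \<bar>u x\<bar>)"
    and u_meas [measurable]: "u \<in> borel_measurable lebesgue"
    and uq_int: "\<And>r. integrable lebesgue (\<lambda>x. indicator (cball 0 r) x * \<bar>u x\<bar> powr q)"
  proof -
    show "AE x in lebesgue. u x > 0" "u \<in> borel_measurable lebesgue"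
      using super by (auto simp: positive_distributional_supersolution_def Lq_loc_def)
    show "integrable lebesgue (\<lambda>x. indicator (cball 0 r) x * \<bar>u x\<bar> powr q)" for r
      using super compact_cball[of 0 r]
      by (auto simp: positive_distributional_supersolution_def Lq_loc_def set_integrable_def)
    have "u absolutely_integrable_on cball 0 r" for r
      using super compact_cball[of 0 r]
      by (auto simp: positive_distributional_supersolution_def L2s_def L1_loc_def)
    then have "integrable lebesgue (\<lambda>x. \<bar>indicator (cball 0 r) x *\<^sub>R u x\<bar>)" for r
      unfolding set_integrable_def by (rule integrable_abs)
    then show "integrable lebesgue (\<lambda>x. indicator (cball 0 r) x * \<bar>u x\<bar>)" for r
      by (simp add: abs_mult)
  qed
  have ns: "?n - 2 * s > 0" using n s by linarith
  have exponent: "?n \<le> 2 * s * (q / (q - 1))"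
  proof -
    have "q * (?n - 2 * s) \<le> ?n" using q ns by (simp add: pos_le_divide_eq)
    then have "?n * (q - 1) \<le> 2 * s * q" by (simp add: algebra_simps)
    then show ?thesis using q1 by (simp add: pos_le_divide_eq)
  qed
  (* With k q >= k + 1 the q-th power of eta^k is at most the test function eta^(k + 1). *)
  obtain k0 :: nat where "1 / (q - 1) \<le> real k0" using real_arch_simple by blast
  define k where "k = Suc k0"
  have k: "k > 0" and kq: "real (Suc k) \<le> real k * q"
  proof -
    have "1 / (q - 1) \<le> real k" using \<open>1 / (q - 1) \<le> real k0\<close> by (simp add: k_def)
    then have "1 \<le> real k * (q - 1)" using q1 by (simp add: pos_divide_le_eq)
    then show "real (Suc k) \<le> real k * q" by (simp add: algebra_simps)
  qed (simp add: k_def)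
  obtain D where D: "D > 0"
    and op: "\<And>R (x :: real ^ 'n). R \<ge> 1 \<Longrightarrow>
      - laplacian (\<lambda>x. cutoff R x ^ Suc k) x + frac_laplacian s (\<lambda>x. cutoff R x ^ Suc k) x
        \<le> D * R powr (- 2 * s) * cutoff R x ^ k"
    using cutoff_operator_le[OF s k] by blast
  define Q where "Q = q / (q - 1)"
  define E where "E R = D * R powr (- 2 * s)" for R
  define Y where "Y \<Lambda> = \<Lambda> powr (- (1 / (q - 1)))" for \<Lambda> :: real
  define Z where "Z = unit_ball_vol ?n * D powr Q"
  define \<phi> where "\<phi> R x = cutoff R x ^ Suc k" for R and x :: "real ^ 'n"
  define I where "I r = (LINT x|lebesgue. indicator (cball 0 r) x * \<bar>u x\<bar>)" for r
  define J where "J r = (LINT x|lebesgue. indicator (cball 0 r) x * \<bar>u x\<bar> powr q)" for r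
  define P where "P R M = (LINT x|lebesgue. indicator (- cball 0 M) x * (\<bar>u x\<bar> powr q * \<phi> R x))" for R M
  define T where "T R = (LINT x|lebesgue. \<bar>u x\<bar> powr q * \<phi> R x)" for R
  have E_pos: "R \<ge> 1 \<Longrightarrow> E R > 0" for R using D by (simp add: E_def)
  have \<phi>: "0 \<le> \<phi> R x" "\<phi> R x \<le> 1" for R x
    using cutoff_props(1,2)[of R x] by (auto simp: \<phi>_def intro!: mult_le_one power_le_one)
  have \<phi>0: "\<phi> R x = 0" if "R > 0" "x \<notin> cball 0 R" for R x
    using cutoff_props(4)[OF that(1), of x] that(2) by (simp add: \<phi>_def)
  have \<phi>_smooth: "smooth_fun (\<phi> R)" for R
    unfolding \<phi>_def[abs_def] by (rule smooth_fun_power[OF cutoff_props(3)])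
  have [measurable]: "\<phi> R \<in> borel_measurable lebesgue" for R
    by (rule measurable_completion)
       (simp add: borel_measurable_continuous_onI[OF smooth_fun_continuous[OF \<phi>_smooth]])
  have [measurable]: "cball (0 :: real ^ 'n) r \<in> sets lebesgue" "- cball (0 :: real ^ 'n) r \<in> sets lebesgue" for r
    using sets_completionI_sets[of "cball 0 r" lborel] sets_completionI_sets[of "- cball 0 r" lborel]
    by (simp_all add: borel_comp)
  have \<phi>_le: "\<bar>u x\<bar> powr q * \<phi> R x \<le> indicator (cball 0 R) x * \<bar>u x\<bar> powr q" if "R > 0" for R x
    using \<phi>[of R x] \<phi>0[OF that, of x] by (cases "x \<in> cball 0 R") (auto intro: mult_left_le)
  have T_int: "integrable lebesgue (\<lambda>x. \<bar>u x\<bar> powr q * \<phi> R x)" if "R > 0" for R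
  proof (rule Bochner_Integration.integrable_bound[OF uq_int[of R]])
    show "AE x in lebesgue. norm (\<bar>u x\<bar> powr q * \<phi> R x) \<le> norm (indicator (cball 0 R) x * \<bar>u x\<bar> powr q)"
      using \<phi>_le[OF that] \<phi> by (intro AE_I2) (simp add: abs_mult)
  qed measurable
  have P_int: "integrable lebesgue (\<lambda>x. indicator (- cball 0 M) x * (\<bar>u x\<bar> powr q * \<phi> R x))" if "R > 0" for R M
  proof (rule Bochner_Integration.integrable_bound[OF T_int[OF that]])
    show "AE x in lebesgue. norm (indicator (- cball 0 M) x * (\<bar>u x\<bar> powr q * \<phi> R x)) \<le> norm (\<bar>u x\<bar> powr q * \<phi> R x)"
      by (intro AE_I2) (simp add: indicator_def)
  qed measurable
  define c where "c = exp (- (4 / 3) :: real) ^ Suc k"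
  have c: "c > 0" by (simp add: c_def)
  have lower: "c * J (R / 2) \<le> T R" if "R > 0" for R
  proof -
    have "c * J (R / 2) = (LINT x|lebesgue. c * (indicator (cball 0 (R / 2)) x * \<bar>u x\<bar> powr q))"
      by (simp add: J_def)
    also have "\<dots> \<le> T R" unfolding T_def
    proof (rule integral_mono)
      show "integrable lebesgue (\<lambda>x. c * (indicator (cball 0 (R / 2)) x * \<bar>u x\<bar> powr q))"
        by (intro integrable_mult_right uq_int)
      show "integrable lebesgue (\<lambda>x. \<bar>u x\<bar> powr q * \<phi> R x)" by (rule T_int[OF that])
      fix x
      show "c * (indicator (cball 0 (R / 2)) x * \<bar>u x\<bar> powr q) \<le> \<bar>u x\<bar> powr q * \<phi> R x"
      proof (cases "x \<in> cball 0 (R / 2)")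
        case True
        then have "exp (- (4 / 3)) \<le> cutoff R x" by (intro cutoff_props(5)[OF that]) simp
        then have "c \<le> \<phi> R x" unfolding c_def \<phi>_def by (intro power_mono) simp_all
        then have "\<bar>u x\<bar> powr q * c \<le> \<bar>u x\<bar> powr q * \<phi> R x" by (intro mult_left_mono) simp_all
        then show ?thesis using True by (simp add: mult.commute)
      next
        case False
        then show ?thesis using \<phi>(1)[of R x] by simp
      qed
    qed
    finally show ?thesis .
  qed
  have upper: "T R \<le> E R * I M + \<Lambda> * P R M + Y \<Lambda> * Z" if R: "R \<ge> 1" and \<Lambda>: "\<Lambda> > 0" for R M \<Lambda>
  proof -
    have R0: "R > 0" using R by simp
    let ?L = "\<lambda>x. - laplacian (\<phi> R) x + frac_laplacian s (\<phi> R) x"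
    have "T R = (LINT x|lebesgue. u x powr q * \<phi> R x)"
      unfolding T_def
    proof (rule integral_cong_AE)
      show "AE x in lebesgue. \<bar>u x\<bar> powr q * \<phi> R x = u x powr q * \<phi> R x"
        using u_pos by eventually_elim simp
    qed measurable
    also have "\<dots> \<le> (LINT x|lebesgue. u x * ?L x)"
    proof -
      have "test_function (\<phi> R)" unfolding \<phi>_def[abs_def] by (rule test_function_cutoff_power[OF R0])
      then show ?thesis
        using super \<phi>(1) unfolding positive_distributional_supersolution_def by blast
    qed
    also have "\<dots> \<le> E R * I M + \<Lambda> * P R M + Y \<Lambda> * E R powr Q * measure lebesgue (cball (0 :: real ^ 'n) R)"
    proof -
      define G where "G x = E R * (indicator (cball 0 M) x * \<bar>u x\<bar>)
        + \<Lambda> * (indicator (- cball 0 M) x * (\<bar>u x\<bar> powr q * \<phi> R x))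
        + Y \<Lambda> * E R powr Q * indicator (cball 0 R) x" for x
      have i3: "integrable lebesgue (\<lambda>x :: real ^ 'n. indicator (cball 0 R) x :: real)"
        using lmeasurable_cball[of "0 :: real ^ 'n" R]
        by (intro integrable_real_indicator) (simp_all only: fmeasurable_def mem_Collect_eq infinity_ennreal_def)
      have G_int: "integrable lebesgue G"
        unfolding G_def[abs_def] by (intro Bochner_Integration.integrable_add integrable_mult_right u_int P_int R0 i3)
      have G0: "G x \<ge> 0" for x
        unfolding G_def using E_pos[OF R] \<Lambda> \<phi>(1)[of R x] by (intro add_nonneg_nonneg mult_nonneg_nonneg) (auto simp: Y_def)
      have G_eq: "(LINT x|lebesgue. G x) = E R * I M + \<Lambda> * P R M + Y \<Lambda> * E R powr Q * measure lebesgue (cball (0 :: real ^ 'n) R)"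
        unfolding G_def I_def P_def using u_int P_int[OF R0] i3 by simp
      have le: "AE x in lebesgue. u x * ?L x \<le> G x"
        using u_pos
      proof eventually_elim
        case (elim x)
        have L: "?L x \<le> E R * cutoff R x ^ k" unfolding E_def \<phi>_def[abs_def] by (rule op[OF R])
        have \<eta>: "0 \<le> cutoff R x" "cutoff R x \<le> 1" by (rule cutoff_props)+
        have "u x * ?L x \<le> u x * (E R * cutoff R x ^ k)" using elim by (intro mult_left_mono[OF L]) simp
        also have "\<dots> = (u x * cutoff R x ^ k) * E R" by simp
        finally have uL: "u x * ?L x \<le> (u x * cutoff R x ^ k) * E R" .
        show ?case
        proof (cases "x \<in> cball 0 R")
          case False
          then have "cutoff R x = 0" by (intro cutoff_props(4)[OF R0]) simp
          then show ?thesis using uL k G0[of x] by (simp add: zero_power)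
        next
          case xR: True
          show ?thesis
          proof (cases "x \<in> cball 0 M")
            case True
            have "(u x * cutoff R x ^ k) * E R \<le> (u x * 1) * E R"
              using elim \<eta> E_pos[OF R] by (intro mult_right_mono mult_left_mono power_le_one) auto
            moreover have "G x = (u x * 1) * E R + Y \<Lambda> * E R powr Q" using True xR elim by (simp add: G_def)
            moreover have "0 \<le> Y \<Lambda> * E R powr Q" by (simp add: Y_def)
            ultimately show ?thesis using uL by linarith
          next
            case False
            have "(u x * cutoff R x ^ k) * E R
                \<le> \<Lambda> * (u x * cutoff R x ^ k) powr q + Y \<Lambda> * E R powr Q"
              unfolding Y_def Q_def using elim \<eta> E_pos[OF R] \<Lambda> q1 by (intro young_ineq) auto
            also have "(u x * cutoff R x ^ k) powr q \<le> \<bar>u x\<bar> powr q * \<phi> R x"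
            proof (cases "cutoff R x = 0")
              case True
              then show ?thesis using k by (simp add: zero_power \<phi>_def)
            next
              case False
              then have \<eta>0: "cutoff R x > 0" using \<eta> by simp
              have "(cutoff R x ^ k) powr q = cutoff R x powr (real k * q)"
                using \<eta>0 by (simp add: powr_realpow[symmetric] powr_powr)
              also have "\<dots> \<le> cutoff R x powr real (Suc k)"
                using \<eta> kq by (intro powr_mono') auto
              also have "\<dots> = \<phi> R x" unfolding \<phi>_def by (rule powr_realpow[OF \<eta>0])
              finally have "(cutoff R x ^ k) powr q \<le> \<phi> R x" .
              then have "u x powr q * (cutoff R x ^ k) powr q \<le> u x powr q * \<phi> R x"
                by (intro mult_left_mono) auto
              then show ?thesis using elim \<eta> by (simp add: powr_mult)
            qed
            finally show ?thesis using uL xR False \<Lambda> by (simp add: G_def)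
          qed
        qed
      qed
      (* If the left side is not integrable, its integral has the value 0, and the bound holds as well. *)
      show ?thesis
      proof (cases "integrable lebesgue (\<lambda>x. u x * ?L x)")
        case True
        show ?thesis unfolding G_eq[symmetric] by (rule integral_mono_AE[OF True G_int le])
      next
        case False
        then have "(LINT x|lebesgue. u x * ?L x) = 0" by (rule not_integrable_integral_eq)
        then show ?thesis unfolding G_eq[symmetric] using G0 by (simp add: integral_nonneg_AE)
      qed
    qed
    also have "E R powr Q * measure lebesgue (cball (0 :: real ^ 'n) R) \<le> Z"
    proof -
      have "measure lebesgue (cball (0 :: real ^ 'n) R) = unit_ball_vol ?n * R powr ?n"
        using R0 content_cball[of R "0 :: real ^ 'n"] by (simp add: powr_realpow)
      moreover have "E R powr Q = D powr Q * R powr (- (2 * s * Q))"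
        using D by (simp add: E_def powr_mult powr_powr)
      moreover have "R powr (- (2 * s * Q)) * R powr ?n \<le> 1"
      proof -
        have "R powr (- (2 * s * Q)) * R powr ?n = R powr (?n - 2 * s * Q)"
          by (simp add: powr_add[symmetric])
        also have "\<dots> \<le> R powr 0" using R exponent by (intro powr_mono) (auto simp: Q_def)
        finally show ?thesis using R by simp
      qed
      then have "(unit_ball_vol ?n * D powr Q) * (R powr (- (2 * s * Q)) * R powr ?n) \<le> (unit_ball_vol ?n * D powr Q) * 1"
        by (rule mult_left_mono) simp
      ultimately show ?thesis by (simp add: Z_def mult_ac)
    qed
    then have "Y \<Lambda> * E R powr Q * measure lebesgue (cball (0 :: real ^ 'n) R) \<le> Y \<Lambda> * Z"
      unfolding mult.assoc by (rule mult_left_mono) (simp add: Y_def)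
    finally show ?thesis by simp
  qed
  have T_le: "T R \<le> 2 * (Y (1 / 2) * Z)" if "R \<ge> 1" for R
  proof -
    (* The ball of radius -1 is empty. *)
    have "P R (- 1) = T R" "I (- 1) = 0" by (simp_all add: P_def T_def I_def)
    then show ?thesis using upper[OF that, of "1 / 2" "- 1"] by simp
  qed
  have P_le: "P R M \<le> J R - J M" if "M \<le> R" "R > 0" for M R
  proof -
    have "P R M \<le> (LINT x|lebesgue. indicator (cball 0 R) x * \<bar>u x\<bar> powr q - indicator (cball 0 M) x * \<bar>u x\<bar> powr q)"
      unfolding P_def
    proof (rule integral_mono)
      fix x
      show "indicator (- cball 0 M) x * (\<bar>u x\<bar> powr q * \<phi> R x)
        \<le> indicator (cball 0 R) x * \<bar>u x\<bar> powr q - indicator (cball 0 M) x * \<bar>u x\<bar> powr q"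
        using \<phi>_le[OF that(2), of x] that(1) by (auto simp: indicator_def)
    qed (intro P_int that uq_int Bochner_Integration.integrable_diff)+
    then show ?thesis using uq_int by (simp add: J_def)
  qed
  have J_mono: "J r \<le> J r'" if "r \<le> r'" for r r'
    unfolding J_def
    by (rule integral_mono) (use that uq_int in \<open>auto simp: indicator_def\<close>)
  (* Along integers, the radii N and 2 N give the same limit of J. *)
  define j where "j N = J (real N)" for N :: nat
  have "incseq j" by (auto simp: incseq_def j_def intro: J_mono)
  moreover have "j N \<le> 2 * (Y (1 / 2) * Z) / c" for N
  proof -
    have "j N \<le> J (2 * real (Suc N) / 2)" unfolding j_def by (rule J_mono) simp
    moreover have "c * J (2 * real (Suc N) / 2) \<le> 2 * (Y (1 / 2) * Z)"
      by (rule order_trans[OF lower T_le]) simp_all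
    then have "J (2 * real (Suc N) / 2) \<le> 2 * (Y (1 / 2) * Z) / c"
      using c by (simp only: pos_le_divide_eq mult.commute)
    ultimately show ?thesis by linarith
  qed
  ultimately obtain l where l: "j \<longlonglongrightarrow> l" "\<And>N. j N \<le> l"
    using incseq_convergent[of j] by blast
  have l2: "(\<lambda>N. j (2 * N)) \<longlonglongrightarrow> l"
    using LIMSEQ_subseq_LIMSEQ[OF l(1), of "\<lambda>N. 2 * N"] by (simp add: strict_mono_def o_def)
  have bound: "c * l \<le> Y \<Lambda> * Z" if \<Lambda>: "\<Lambda> > 0" for \<Lambda>
  proof -
    have "c * l \<le> (D * 0) * I M + \<Lambda> * (l - j M) + Y \<Lambda> * Z" for M
    proof (rule LIMSEQ_le)
      show "(\<lambda>N. c * j N) \<longlonglongrightarrow> c * l" by (intro tendsto_intros l)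
      have "(\<lambda>N. E (real (2 * N))) \<longlonglongrightarrow> D * 0"
        unfolding E_def using s
        by (intro tendsto_mult tendsto_const tendsto_neg_powr filterlim_compose[OF filterlim_real_sequentially])
           (auto intro!: filterlim_subseq simp: strict_mono_def)
      then show "(\<lambda>N. E (real (2 * N)) * I M + \<Lambda> * (j (2 * N) - j M) + Y \<Lambda> * Z)
          \<longlonglongrightarrow> (D * 0) * I M + \<Lambda> * (l - j M) + Y \<Lambda> * Z"
        by (intro tendsto_intros l2)
      have "c * j N \<le> E (real (2 * N)) * I M + \<Lambda> * (j (2 * N) - j M) + Y \<Lambda> * Z" if "N \<ge> Suc M" for N
      proof -
        have "c * j N \<le> T (real (2 * N))" using lower[of "real (2 * N)"] that by (simp add: j_def)
        also have "\<dots> \<le> E (real (2 * N)) * I M + \<Lambda> * P (real (2 * N)) M + Y \<Lambda> * Z"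
          using that by (intro upper \<Lambda>) simp
        also have "\<Lambda> * P (real (2 * N)) M \<le> \<Lambda> * (j (2 * N) - j M)"
          unfolding j_def using that \<Lambda> by (intro mult_left_mono P_le) auto
        finally show ?thesis by simp
      qed
      then show "\<exists>N0. \<forall>N\<ge>N0. c * j N \<le> E (real (2 * N)) * I M + \<Lambda> * (j (2 * N) - j M) + Y \<Lambda> * Z" by blast
    qed
    then have "c * l \<le> \<Lambda> * (l - j M) + Y \<Lambda> * Z" for M by simp
    moreover have "(\<lambda>M. \<Lambda> * (l - j M) + Y \<Lambda> * Z) \<longlonglongrightarrow> \<Lambda> * (l - l) + Y \<Lambda> * Z"
      by (intro tendsto_intros l)
    ultimately show ?thesis using LIMSEQ_le_const by fastforce
  qed
  have "((\<lambda>\<Lambda>. Y \<Lambda> * Z) \<longlongrightarrow> 0 * Z) at_top"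
    unfolding Y_def using q1 by (intro tendsto_mult tendsto_const tendsto_neg_powr filterlim_ident) auto
  then have "c * l \<le> 0 * Z"
    by (rule tendsto_lowerbound) (auto intro!: eventually_mono[OF eventually_gt_at_top[of 0]] bound)
  then have "l \<le> 0" using c by (simp add: mult_le_0_iff)
  then have "J 1 \<le> 0" using l(2)[of 1] by (simp add: j_def)
  then have "J 1 = 0" unfolding J_def by (intro antisym integral_nonneg_AE) auto
  then have "AE x in lebesgue. indicator (cball 0 1) x * \<bar>u x\<bar> powr q = 0"
    unfolding J_def using integral_nonneg_eq_0_iff_AE[OF uq_int[of 1]] by auto
  with u_pos have "AE x in lebesgue. x \<notin> cball (0 :: real ^ 'n) 1"
    by eventually_elim (auto simp: indicator_def split: if_splits)
  then have "emeasure lebesgue (cball (0 :: real ^ 'n) 1) = 0"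
  proof (rule AE_iff_measurable[THEN iffD1, rotated -1])
    show "{x \<in> space lebesgue. \<not> x \<notin> cball (0 :: real ^ 'n) 1} = cball 0 1" by auto
  qed measurable
  then have "measure lebesgue (cball (0 :: real ^ 'n) 1) = 0" by (simp add: measure_def)
  then show False using content_cball[of 1 "0 :: real ^ 'n"] unit_ball_vol_pos[of ?n] by simp
qed

theorem theorem1p1:
  fixes s q :: real
  assumes "CARD('n::finite) \<ge> 3"
    and "0 < s" "s < 1"
    and "q > 1"
  shows "(q \<le> real CARD('n) / (real CARD('n) - 2 * s) \<longrightarrow>
      \<not> (\<exists>u :: real ^ 'n \<Rightarrow> real. positive_distributional_supersolution s q u)) \<and>
    (q > real CARD('n) / (real CARD('n) - 2 * s) \<longrightarrow>
      (\<exists>u :: real ^ 'n \<Rightarrow> real. smooth_fun u \<and> bounded (range u) \<and>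
         positive_classical_supersolution s q u))"
  using no_positive_distributional_supersolution[OF assms]
    exists_positive_classical_supersolution[OF assms(1-3)] by blast

end
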